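(* Let $R>0$ and let $A:\mathbb{R}^2\to\mathbb{R}$ be given by $A(x)=-1$ for $|x|\le R$ and $A(x)=+1$ for $|x|>R$ (no core). For $\eta>0$ set $a_\eta(x)=A(x)+i\eta$. Let $q>R$ and let $f=F\,\mathcal{H}^1\lfloor\partial B_q(0)$, where $F:\partial B_q(0)\to\mathbb{R}$, $F\in L^2(\partial B_q(0))$, $\int_{\partial B_q(0)}F\,d\mathcal{H}^1=0$ and $F\neq 0$. Let $u_\eta$ be the solution of $\nabla\cdot(a_\eta\nabla u_\eta)=f$ on $\mathbb{R}^2$ with $\nabla u_\eta\to0$ as $|x|\to\infty$. Then the configuration is resonant; more precisely, $E_\eta(u_\eta)\to\infty$ as $\eta\to0$.
   Context: $B_r(x_0)$ is the disk of radius $r$ centered at $x_0$ in $\mathbb{R}^2$; $\mathcal{H}^1\lfloor\Gamma$ is one-dimensional Hausdorff measure restricted to the curve $\Gamma$, so that $f$ acts on test functions by $\langle f,\varphi\rangle=\int_{\partial B_q(0)}F\varphi\,d\mathcal{H}^1$. $\dot H^1(\mathbb{R}^2)=\{U\in L^2_{\mathrm{loc}}(\mathbb{R}^2): \nabla U\in L^2(\mathbb{R}^2)\}$ (real- or complex-valued functions). For each $\eta>0$, $u_\eta\in\dot H^1(\mathbb{R}^2)$ is the complex-valued weak solution, unique up to an additive constant, of $\nabla\cdot(a_\eta\nabla u_\eta)=f$. The energy is $E_\eta(u_\eta)=\frac{\eta}{2}\int_{\mathbb{R}^2}|\nabla u_\eta|^2\,dx$, and a configuration (coefficient $A$ and source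 $f$) is called resonant if $\limsup_{\eta\to0}E_\eta(u_\eta)=\infty$, and non-resonant otherwise. *)

theory Defs
  imports "HOL-Analysis.Analysis"
begin

section \<open>One-dimensional Hausdorff measure\<close>

text \<open>Boundedness of the covering sets is required separately because \<^const>\<open>diameter\<close> is
  meaningless for unbounded sets. In dimension one the usual normalising constant is 1.\<close>

definition hausdorff1_pre :: "real \<Rightarrow> 'a::metric_space set \<Rightarrow> ennreal" where
  "hausdorff1_pre \<delta> S =
     (INF C \<in> {C :: nat \<Rightarrow> 'a set. S \<subseteq> (\<Union>i. C i) \<and> (\<forall>i. bounded (C i) \<and> diameter (C i) \<le> \<delta>)}.
        \<Sum>i. ennreal (diameter (C i)))"

definition hausdorff1_outer :: "'a::metric_space set \<Rightarrow> ennreal" where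
  "hausdorff1_outer S = (SUP \<delta> \<in> {0<..}. hausdorff1_pre \<delta> S)"

text \<open>The outer measure above is a metric outer measure, hence countably additive on the Borel
  sets, so \<^const>\<open>measure_of\<close> does not collapse to the null measure here.\<close>

definition hausdorff1 :: "'a::metric_space measure" where
  "hausdorff1 = measure_of UNIV (sets borel) hausdorff1_outer"

text \<open>\<open>\<H>\<^sup>1\<lfloor>\<Gamma>\<close>, completed, so that functions on \<open>\<Gamma>\<close> need only be measurable up to null sets.\<close>

definition hausdorff1_on :: "'a::metric_space set \<Rightarrow> 'a measure" where
  "hausdorff1_on \<Gamma> = completion (restrict_space hausdorff1 \<Gamma>)"


section \<open>Function spaces\<close>

definition square_integrable ::
    "'a measure \<Rightarrow> ('a \<Rightarrow> 'b::{real_normed_vector, second_countable_topology}) \<Rightarrow> bool" where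
  "square_integrable M f \<longleftrightarrow> f \<in> borel_measurable M \<and> integrable M (\<lambda>x. (norm (f x))\<^sup>2)"

definition locally_integrable ::
    "('a::euclidean_space \<Rightarrow> 'b::{banach, second_countable_topology}) \<Rightarrow> bool" where
  "locally_integrable f \<longleftrightarrow>
     f \<in> borel_measurable lebesgue \<and> (\<forall>K. compact K \<longrightarrow> set_integrable lebesgue K f)"

definition locally_square_integrable ::
    "('a::euclidean_space \<Rightarrow> 'b::{real_normed_vector, second_countable_topology}) \<Rightarrow> bool" where
  "locally_square_integrable f \<longleftrightarrow>
     f \<in> borel_measurable lebesgue \<and>
     (\<forall>K. compact K \<longrightarrow> set_integrable lebesgue K (\<lambda>x. (norm (f x))\<^sup>2))"

definition partial_deriv :: "'n::finite \<Rightarrow> (real ^ 'n \<Rightarrow> real) \<Rightarrow> real ^ 'n \<Rightarrow> real" where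
  "partial_deriv i f x = frechet_derivative f (at x) (axis i 1)"

fun cont_diff :: "nat \<Rightarrow> (real ^ 'n::finite \<Rightarrow> real) \<Rightarrow> bool" where
  "cont_diff 0 f \<longleftrightarrow> continuous_on UNIV f"
| "cont_diff (Suc k) f \<longleftrightarrow>
     (\<forall>x. f differentiable (at x)) \<and> (\<forall>i. cont_diff k (partial_deriv i f))"

definition test_function :: "(real ^ 'n::finite \<Rightarrow> real) \<Rightarrow> bool" where
  "test_function \<phi> \<longleftrightarrow> (\<forall>k. cont_diff k \<phi>) \<and> compact (closure {x. \<phi> x \<noteq> 0})"

definition has_weak_gradient ::
    "(real ^ 'n::finite \<Rightarrow> complex) \<Rightarrow> (real ^ 'n \<Rightarrow> complex ^ 'n) \<Rightarrow> bool" where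
  "has_weak_gradient u G \<longleftrightarrow>
     locally_integrable u \<and> locally_integrable G \<and>
     (\<forall>\<phi> i. test_function \<phi> \<longrightarrow>
        (LINT x|lebesgue. u x * of_real (partial_deriv i \<phi> x)) =
        - (LINT x|lebesgue. G x $ i * of_real (\<phi> x)))"

text \<open>The weak gradient is determined only almost everywhere; a representative is chosen.\<close>

definition weak_grad :: "(real ^ 'n::finite \<Rightarrow> complex) \<Rightarrow> real ^ 'n \<Rightarrow> complex ^ 'n" where
  "weak_grad u = (SOME G. has_weak_gradient u G)"

definition H1_dot :: "(real ^ 'n::finite \<Rightarrow> complex) set" where
  "H1_dot = {u. locally_square_integrable u \<and> (\<exists>G. has_weak_gradient u G) \<and>
                square_integrable lebesgue (weak_grad u)}"

definition ae_vanishes_at_infinity :: "(real ^ 'n::finite \<Rightarrow> complex ^ 'n) \<Rightarrow> bool" where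
  "ae_vanishes_at_infinity G \<longleftrightarrow>
     (\<forall>\<epsilon>>0. \<exists>\<rho>. AE x in lebesgue. norm x > \<rho> \<longrightarrow> norm (G x) < \<epsilon>)"


section \<open>The equation, its energy, and resonance\<close>

text \<open>Sources are represented by their action on test functions. Since they are real distributions
  and the equation is complex linear, real test functions suffice. The sign comes from integrating
  \<open>\<nabla> \<cdot> (a \<nabla>u) = f\<close> by parts; the product of gradients is bilinear, without conjugation.\<close>

definition weak_solution ::
    "(real ^ 'n::finite \<Rightarrow> complex) \<Rightarrow> ((real ^ 'n \<Rightarrow> real) \<Rightarrow> real) \<Rightarrow> (real ^ 'n \<Rightarrow> complex) \<Rightarrow> bool"
  where
  "weak_solution a f u \<longleftrightarrow>
     u \<in> H1_dot \<and>
     (\<forall>\<phi>. test_function \<phi> \<longrightarrow>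
        - (LINT x|lebesgue. a x * (\<Sum>i\<in>UNIV. weak_grad u x $ i * of_real (partial_deriv i \<phi> x))) =
        of_real (f \<phi>))"

definition curve_source ::
    "(real ^ 2) set \<Rightarrow> (real ^ 2 \<Rightarrow> real) \<Rightarrow> (real ^ 2 \<Rightarrow> real) \<Rightarrow> real" where
  "curve_source \<Gamma> F \<phi> = (LINT x|hausdorff1_on \<Gamma>. F x * \<phi> x)"

definition lossy_coeff :: "(real ^ 2 \<Rightarrow> real) \<Rightarrow> real \<Rightarrow> real ^ 2 \<Rightarrow> complex" where
  "lossy_coeff A \<eta> x = of_real (A x) + \<i> * of_real \<eta>"

definition energy :: "real \<Rightarrow> (real ^ 2 \<Rightarrow> complex) \<Rightarrow> real" where
  "energy \<eta> u = \<eta> / 2 * (LINT x|lebesgue. (norm (weak_grad u x))\<^sup>2)"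

definition solution_family ::
    "(real ^ 2 \<Rightarrow> real) \<Rightarrow> ((real ^ 2 \<Rightarrow> real) \<Rightarrow> real) \<Rightarrow> (real \<Rightarrow> real ^ 2 \<Rightarrow> complex) \<Rightarrow> bool" where
  "solution_family A f u \<longleftrightarrow> (\<forall>\<eta>>0. weak_solution (lossy_coeff A \<eta>) f (u \<eta>))"

text \<open>Solutions are unique only up to additive constants, which do not affect the energy, so
  the condition does not depend on the family. The first conjunct prevents a configuration without
  solutions from being vacuously resonant.\<close>

definition resonant :: "(real ^ 2 \<Rightarrow> real) \<Rightarrow> ((real ^ 2 \<Rightarrow> real) \<Rightarrow> real) \<Rightarrow> bool" where
  "resonant A f \<longleftrightarrow>
     (\<exists>u. solution_family A f u) \<and>
     (\<forall>u. solution_family A f u \<longrightarrow>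
        Limsup (at_right 0) (\<lambda>\<eta>. ereal (energy \<eta> (u \<eta>))) = \<infinity>)"

definition coreless_coeff :: "real \<Rightarrow> real ^ 2 \<Rightarrow> real" where
  "coreless_coeff R x = (if norm x \<le> R then -1 else 1)"

end

theory Submission
  imports Defs
begin

text \<open>
  The interface \<open>|x| = R\<close> between the coefficients \<open>-1\<close> and \<open>+1\<close> carries surface plasmons. With
  \<open>z = x\<^sub>1 + i x\<^sub>2\<close> and \<open>k \<ge> 1\<close>, let \<open>\<Psi> = w z^k\<close> for \<open>|x| \<le> R\<close> and \<open>\<Psi> = w R^(2k) / conj(z)^k\<close> for
  \<open>|x| > R\<close>. This function is continuous, holomorphic inside and antiholomorphic outside, so the
  Cauchy-Riemann equations change sign exactly where \<open>A\<close> does: writing \<open>\<Psi> = \<phi> + i \<psi>\<close>, the field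
  \<open>A \<nabla>\<phi>\<close> is the rotated gradient \<open>(-\<partial>\<^sub>2\<psi>, \<partial>\<^sub>1\<psi>)\<close> in the whole plane. A rotated gradient is orthogonal to
  every gradient, so testing \<open>\<nabla> \<cdot> ((A + i\<eta>)\<nabla>u) = f\<close> with \<open>\<phi>\<close> leaves only the loss term:
  \<open>\<langle>f, \<phi>\<rangle> = - i \<eta> \<integral> \<nabla>u \<cdot> \<nabla>\<phi>\<close>. By Cauchy-Schwarz \<open>\<langle>f, \<phi>\<rangle>\<^sup>2 \<le> \<eta>\<^sup>2 \<parallel>\<nabla>u\<parallel>\<^sup>2 \<parallel>\<nabla>\<phi>\<parallel>\<^sup>2\<close>, and hence the energy is at
  least \<open>\<langle>f, \<phi>\<rangle>\<^sup>2 / (2 \<eta> \<parallel>\<nabla>\<phi>\<parallel>\<^sup>2)\<close>, which tends to infinity as soon as a single plasmon is excited, that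
  is, \<open>\<langle>f, \<phi>\<rangle> \<noteq> 0\<close> for some \<open>k \<ge> 1\<close> and \<open>w\<close>.

  Two points need work. The wave \<open>\<phi>\<close> is not an admissible test function: it has a kink at \<open>|x| = R\<close> and
  unbounded support. It is replaced by \<open>Re (w z^k p\<^sub>n(|x|\<^sup>2))\<close> with explicit smooth profiles \<open>p\<^sub>n\<close> that
  vanish far away (\<open>plasmon\<close>, \<open>profile\<close>). Their gradients are dominated by one square
  integrable function (\<open>partial_derivs_plasmon_bound\<close>), and the defect in the rotated-gradient identity
  tends to zero off the interface (\<open>plasmon_flux_defect_tendsto_0\<close>), so that the argument survives in the
  limit (\<open>flux_estimate\<close>, \<open>energy_lower_bound\<close>).

  Secondly, some plasmon is excited. On the circle of radius \<open>q > R\<close> every test wave is a constant times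
  \<open>Re (w z^k)\<close>. If all these moments of \<open>F\<close>, as well as its mean, vanished, then \<open>F\<close> would be orthogonal to
  all polynomials on the circle, and by the Stone-Weierstrass theorem it would vanish almost
  everywhere (\<open>circle_source_excites_mode\<close>). Passing from square integrability to integrability of \<open>F\<close>
  uses that the circle has finite length (\<open>emeasure_hausdorff1_circle_finite\<close>).
\<close>

section \<open>Smooth functions on Euclidean space\<close>

lemma has_derivative_imp_partial_deriv:
  assumes "(f has_derivative f') (at x)"
  shows "partial_deriv i f x = f' (axis i 1)"
  using frechet_derivative_at[OF assms] by (simp add: partial_deriv_def)

lemma partial_deriv_add:
  assumes "f differentiable (at x)" "g differentiable (at x)"
  shows "partial_deriv i (\<lambda>x. f x + g x) x = partial_deriv i f x + partial_deriv i g x"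
  using has_derivative_imp_partial_deriv[OF has_derivative_add[OF
        assms[unfolded frechet_derivative_works]], of i]
  by (simp add: partial_deriv_def)

lemma partial_deriv_mult:
  assumes "f differentiable (at x)" "g differentiable (at x)"
  shows "partial_deriv i (\<lambda>x. f x * g x) x = f x * partial_deriv i g x + partial_deriv i f x * g x"
  using has_derivative_imp_partial_deriv[OF has_derivative_mult[OF
        assms[unfolded frechet_derivative_works]], of i]
  by (simp add: partial_deriv_def)

lemma partial_deriv_compose:
  assumes "f differentiable (at x)" "(g has_real_derivative d) (at (f x))"
  shows "partial_deriv i (\<lambda>x. g (f x)) x = d * partial_deriv i f x"
  using has_derivative_imp_partial_deriv[OF has_derivative_compose[OF
        assms(1)[unfolded frechet_derivative_works] assms(2)[unfolded has_field_derivative_def]], of i]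
  by (simp add: partial_deriv_def)

lemma partial_deriv_const [simp]: "partial_deriv i (\<lambda>x. c) = (\<lambda>x. 0)"
  using has_derivative_imp_partial_deriv[OF has_derivative_const] by fastforce

lemma partial_deriv_component [simp]: "partial_deriv i (\<lambda>x. x $ j) = (\<lambda>x. axis i 1 $ j)"
  by (rule ext, rule has_derivative_imp_partial_deriv)
     (rule bounded_linear.has_derivative[OF bounded_linear_vec_nth has_derivative_ident])

lemma cont_diff_SucD: "cont_diff (Suc k) f \<Longrightarrow> cont_diff k f"
proof (induction k arbitrary: f)
  case 0
  then show ?case
    by (auto intro!: differentiable_imp_continuous_on simp: differentiable_on_def
        differentiable_at_withinI)
next
  case (Suc k)
  have "cont_diff k (partial_deriv i f)" for i
    using Suc.prems by (intro Suc.IH) auto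
  then show ?case using Suc.prems by simp
qed

lemma cont_diff_const: "cont_diff k (\<lambda>x. c)"
  by (induction k arbitrary: c) simp_all

lemma cont_diff_component: "cont_diff k (\<lambda>x. x $ j)"
  by (cases k) (auto simp: cont_diff_const intro: continuous_intros bounded_linear_imp_differentiable[OF bounded_linear_vec_nth])

lemma cont_diff_add: "cont_diff k f \<Longrightarrow> cont_diff k g \<Longrightarrow> cont_diff k (\<lambda>x. f x + g x)"
proof (induction k arbitrary: f g)
  case 0
  then show ?case by (auto intro: continuous_intros)
next
  case (Suc k)
  then have "partial_deriv i (\<lambda>x. f x + g x) = (\<lambda>x. partial_deriv i f x + partial_deriv i g x)" for i
    by (intro ext partial_deriv_add) auto
  then show ?case using Suc by auto
qed

lemma cont_diff_mult: "cont_diff k f \<Longrightarrow> cont_diff k g \<Longrightarrow> cont_diff k (\<lambda>x. f x * g x)"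
proof (induction k arbitrary: f g)
  case 0
  then show ?case by (auto intro: continuous_intros)
next
  case (Suc k)
  then have "partial_deriv i (\<lambda>x. f x * g x) =
      (\<lambda>x. f x * partial_deriv i g x + partial_deriv i f x * g x)" for i
    by (intro ext partial_deriv_mult) auto
  moreover have "cont_diff k f" "cont_diff k g" using Suc.prems cont_diff_SucD by blast+
  ultimately show ?case using Suc by (auto intro!: cont_diff_add)
qed

text \<open>Carrying a whole sequence of derivatives makes the composition lemma below an induction in which
  the derivative order of the outer function varies freely.\<close>

definition smooth_on :: "real set \<Rightarrow> (real \<Rightarrow> real) \<Rightarrow> bool" where
  "smooth_on S g \<longleftrightarrow>
     (\<exists>D. D 0 = g \<and> (\<forall>n. \<forall>x\<in>S. (D n has_real_derivative D (Suc n) x) (at x)))"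

text \<open>Commuting second partial derivatives make rotated gradients divergence free. They are part of
  the definition because the product and chain rules preserve this symmetry by direct computation.\<close>

definition smooth :: "(real ^ 'n::finite \<Rightarrow> real) \<Rightarrow> bool" where
  "smooth f \<longleftrightarrow> (\<forall>k. cont_diff k f) \<and>
     (\<forall>i j. partial_deriv i (partial_deriv j f) = partial_deriv j (partial_deriv i f))"

lemma smooth_cont_diff: "smooth f \<Longrightarrow> cont_diff k f"
  by (simp add: smooth_def)

lemma smooth_differentiable: "smooth f \<Longrightarrow> f differentiable (at x)"
  using smooth_cont_diff[of f 1] by auto

lemma smooth_differentiable_partial: "smooth f \<Longrightarrow> partial_deriv i f differentiable (at x)"
  using smooth_cont_diff[of f "Suc (Suc 0)"] by auto

lemma smooth_cont_diff_partial: "smooth f \<Longrightarrow> cont_diff k (partial_deriv i f)"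
  using smooth_cont_diff[of f "Suc k"] by auto

lemma smooth_const: "smooth (\<lambda>x. c)"
  by (simp add: smooth_def cont_diff_const)

lemma smooth_component: "smooth (\<lambda>x. x $ j)"
  by (simp add: smooth_def cont_diff_component)

lemma smooth_add:
  assumes "smooth f" "smooth g"
  shows "smooth (\<lambda>x. f x + g x)"
proof -
  note d = assms[THEN smooth_differentiable] assms[THEN smooth_differentiable_partial]
  have "partial_deriv i (\<lambda>x. f x + g x) = (\<lambda>x. partial_deriv i f x + partial_deriv i g x)" for i
    by (intro ext partial_deriv_add d)
  then have "partial_deriv i (partial_deriv j (\<lambda>x. f x + g x)) =
      (\<lambda>x. partial_deriv i (partial_deriv j f) x + partial_deriv i (partial_deriv j g) x)" for i j
    by (auto intro!: partial_deriv_add d)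
  then show ?thesis
    using assms by (simp add: smooth_def cont_diff_add)
qed

lemma smooth_mult:
  assumes "smooth f" "smooth g"
  shows "smooth (\<lambda>x. f x * g x)"
proof -
  note d = assms[THEN smooth_differentiable] assms[THEN smooth_differentiable_partial]
  have 1: "partial_deriv i (\<lambda>x. f x * g x) = (\<lambda>x. f x * partial_deriv i g x + partial_deriv i f x * g x)" for i
    by (intro ext partial_deriv_mult d)
  have "partial_deriv i (partial_deriv j (\<lambda>x. f x * g x)) x =
      f x * partial_deriv i (partial_deriv j g) x + partial_deriv i f x * partial_deriv j g x
      + (partial_deriv j f x * partial_deriv i g x + partial_deriv i (partial_deriv j f) x * g x)" for i j x
    by (simp add: 1 partial_deriv_add partial_deriv_mult d)
  then have "partial_deriv i (partial_deriv j (\<lambda>x. f x * g x)) =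
      partial_deriv j (partial_deriv i (\<lambda>x. f x * g x))" for i j
    using assms by (auto simp: smooth_def fun_eq_iff)
  then show ?thesis
    using assms by (simp add: smooth_def cont_diff_mult)
qed

lemma smooth_power: "smooth f \<Longrightarrow> smooth (\<lambda>x. f x ^ m)"
  by (induction m) (auto intro: smooth_const smooth_mult)

lemma smooth_compose:
  fixes f :: "real ^ 'n::finite \<Rightarrow> real"
  assumes "smooth_on S g" "smooth f" "\<And>x. f x \<in> S"
  shows "smooth (\<lambda>x. g (f x))"
proof -
  obtain D where D0: "D 0 = g"
    and D: "\<And>n y. y \<in> S \<Longrightarrow> (D n has_real_derivative D (Suc n) y) (at y)"
    using assms(1) unfolding smooth_on_def by metis
  have diff: "(\<lambda>x. D n (f x)) differentiable (at x)" for n x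
    using has_derivative_compose[OF smooth_differentiable[OF assms(2), unfolded frechet_derivative_works]
        D[OF assms(3), unfolded has_field_derivative_def]]
    by (auto simp: differentiable_def)
  have p: "partial_deriv i (\<lambda>x. D n (f x)) = (\<lambda>x. D (Suc n) (f x) * partial_deriv i f x)" for i n
    by (intro ext partial_deriv_compose smooth_differentiable assms D)
  have "cont_diff k (\<lambda>x. D n (f x))" for k n
  proof (induction k arbitrary: n)
    case 0
    then show ?case
      using diff by (auto intro!: differentiable_imp_continuous_on simp: differentiable_on_def
          differentiable_at_withinI)
  next
    case (Suc k)
    then show ?case
      using diff p by (auto intro!: cont_diff_mult smooth_cont_diff_partial[OF assms(2)])
  qed
  moreover have "partial_deriv i (partial_deriv j (\<lambda>x. D 0 (f x))) x =
      D 1 (f x) * partial_deriv i (partial_deriv j f) x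
      + D 2 (f x) * partial_deriv i f x * partial_deriv j f x" for i j x
    by (simp add: p partial_deriv_mult diff smooth_differentiable_partial[OF assms(2)] numeral_2_eq_2)
  then have "partial_deriv i (partial_deriv j (\<lambda>x. D 0 (f x))) =
      partial_deriv j (partial_deriv i (\<lambda>x. D 0 (f x)))" for i j
    using assms(2) by (auto simp: smooth_def fun_eq_iff)
  ultimately show ?thesis
    unfolding D0[symmetric] smooth_def by blast
qed

section \<open>One-variable building blocks\<close>

lemma smooth_on_powr: "smooth_on {0<..} (\<lambda>x. x powr a)"
proof -
  define D where "D n x = (\<Prod>i<n. a - real i) * x powr (a - real n)" for n x
  have "(D n has_real_derivative D (Suc n) x) (at x)" if "x > 0" for n x
    unfolding D_def using that
    by (auto intro!: derivative_eq_intros simp: algebra_simps)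
  moreover have "D 0 = (\<lambda>x. x powr a)"
    by (auto simp: D_def)
  ultimately show ?thesis
    unfolding smooth_on_def by (intro exI[of _ D]) auto
qed

text \<open>The functions \<open>P(1/x) exp(-1/x)\<close>, extended by zero, are closed under differentiation. For \<open>P = 1\<close> this
  is the standard smooth function that vanishes exactly on the nonpositive half-line.\<close>

definition flat_exp :: "real poly \<Rightarrow> real \<Rightarrow> real" where
  "flat_exp P x = (if x \<le> 0 then 0 else poly P (1 / x) * exp (- (1 / x)))"

lemma poly_times_exp_minus_tendsto_0: "((\<lambda>y. poly P y * exp (- y)) \<longlongrightarrow> 0) (at_top :: real filter)"
proof -
  have "((\<lambda>y. \<Sum>i\<le>degree P. coeff P i * (y ^ i / exp y)) \<longlongrightarrow> (\<Sum>i\<le>degree P. coeff P i * 0)) at_top"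
    by (intro tendsto_intros tendsto_power_div_exp_0)
  then show ?thesis
    by (simp add: poly_altdef sum_distrib_right exp_minus divide_inverse mult.assoc)
qed

text \<open>Near \<open>0\<close> from the right, \<open>exp(-1/x)\<close> beats every polynomial in \<open>1/x\<close>.\<close>

lemma flat_exp_tendsto_0: "(flat_exp P \<longlongrightarrow> 0) (at 0)"
proof -
  have "((\<lambda>x. poly P (1 / x) * exp (- (1 / x))) \<longlongrightarrow> 0) (at_right (0::real))"
    using filterlim_compose[OF poly_times_exp_minus_tendsto_0 filterlim_inverse_at_top_right, of P]
    by (simp add: inverse_eq_divide)
  then have "(flat_exp P \<longlongrightarrow> 0) (at_right 0)"
    by (rule Lim_transform_eventually) (auto simp: flat_exp_def eventually_at_right_less
        intro: eventually_mono[OF eventually_at_right_less])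
  moreover have "(flat_exp P \<longlongrightarrow> 0) (at_left 0)"
    by (rule tendsto_eventually) (auto simp: flat_exp_def eventually_at_left_real
        intro!: eventually_at_leftI[of "-1"])
  ultimately show ?thesis by (simp add: filterlim_split_at)
qed

lemma flat_exp_has_derivative:
  "(flat_exp P has_real_derivative flat_exp ([:0, 0, 1:] * (P - pderiv P)) x) (at x)"
proof -
  consider "x > 0" | "x < 0" | "x = 0" by linarith
  then show ?thesis
  proof cases
    case 1
    have "((\<lambda>x. poly P (1 / x) * exp (- (1 / x))) has_real_derivative
        flat_exp ([:0, 0, 1:] * (P - pderiv P)) x) (at x)"
      using 1 by (auto intro!: derivative_eq_intros DERIV_chain2[OF poly_DERIV]
          simp: flat_exp_def field_simps power2_eq_square)
    then show ?thesis
      by (rule has_field_derivative_transform_within_open[where S = "{0<..}"])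
         (use 1 in \<open>auto simp: flat_exp_def\<close>)
  next
    case 2
    have "((\<lambda>x. 0) has_real_derivative flat_exp ([:0, 0, 1:] * (P - pderiv P)) x) (at x)"
      using 2 by (simp add: flat_exp_def)
    then show ?thesis
      by (rule has_field_derivative_transform_within_open[where S = "{..<0}"])
         (use 2 in \<open>auto simp: flat_exp_def\<close>)
  next
    case 3
    have "((\<lambda>y. (flat_exp P y - flat_exp P 0) / (y - 0)) \<longlongrightarrow> 0) (at 0)"
      \<comment> \<open>The difference quotient at \<open>0\<close> is the same kind of function with \<open>P\<close> multiplied by the variable.\<close>
      using flat_exp_tendsto_0[of "pCons 0 P"]
      by (rule Lim_transform_eventually) (auto simp: flat_exp_def eventually_at_filter)
    then show ?thesis
      unfolding has_field_derivative_iff 3 by (simp add: flat_exp_def)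
  qed
qed

lemma smooth_on_flat_exp: "smooth_on UNIV (flat_exp P)"
  unfolding smooth_on_def
  by (rule exI[of _ "\<lambda>n. flat_exp (((\<lambda>P. [:0, 0, 1:] * (P - pderiv P)) ^^ n) P)"])
     (use flat_exp_has_derivative in simp)

section \<open>Radial profiles of the regularised plasmon waves\<close>

lemma const_div_square_tendsto_0: "(\<lambda>n. c / (real n)\<^sup>2) \<longlonglongrightarrow> 0"
  by (intro tendsto_divide_0[OF tendsto_const] filterlim_at_top_imp_at_infinity
      filterlim_pow_at_top filterlim_real_sequentially) simp

text \<open>A smooth approximation of \<open>min 1 ((\<rho>/s)^k)\<close>: it is the \<open>(-k/n)\<close>-th power of
  \<open>1 + (s/\<rho>)^n\<close>, and the \<open>n\<close>-th root of the latter tends to \<open>max 1 (s/\<rho>)\<close>.\<close>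

definition rolloff :: "nat \<Rightarrow> real \<Rightarrow> nat \<Rightarrow> real \<Rightarrow> real" where
  "rolloff k \<rho> n s = (1 + (s / \<rho>) ^ n) powr (- real k / real n)"

text \<open>The second factor enforces compact support. It tends to the constant \<open>exp(-1)\<close> rather
  than to \<open>1\<close>, which is harmless since only the size of the limit matters.\<close>

definition profile :: "nat \<Rightarrow> real \<Rightarrow> nat \<Rightarrow> real \<Rightarrow> real" where
  "profile k \<rho> n s = rolloff k \<rho> n s * flat_exp 1 (1 - s / (real n)\<^sup>2)"

definition profile_deriv :: "nat \<Rightarrow> real \<Rightarrow> nat \<Rightarrow> real \<Rightarrow> real" where
  "profile_deriv k \<rho> n s =
     - (real k / \<rho>) * ((s / \<rho>) ^ (n - 1) / (1 + (s / \<rho>) ^ n)) * profile k \<rho> n s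
     - rolloff k \<rho> n s * flat_exp [:0, 0, 1:] (1 - s / (real n)\<^sup>2) / (real n)\<^sup>2"

text \<open>The limit of \<open>rolloff\<close>, \<open>min 1 ((\<rho>/s)^k)\<close>, written so that \<open>s = 0\<close> causes no division by zero.\<close>

definition envelope :: "nat \<Rightarrow> real \<Rightarrow> real \<Rightarrow> real" where
  "envelope k \<rho> s = (if s \<le> \<rho> then 1 else (\<rho> / s) ^ k)"

lemma flat_exp_1_bounds: "0 \<le> flat_exp 1 t" "flat_exp 1 t \<le> 1"
  by (auto simp: flat_exp_def)

text \<open>The derivative of the cutoff \<open>flat_exp 1\<close> is \<open>y\<^sup>2 exp(-y)\<close> at \<open>y = 1/t\<close>.\<close>

lemma flat_exp_deriv_bounds:
  "0 \<le> flat_exp [:0, 0, 1:] t" "flat_exp [:0, 0, 1:] t \<le> 2"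
proof -
  have "y * y * exp (- y) \<le> 2" if "y \<ge> 0" for y :: real
    using exp_lower_Taylor_quadratic[OF that] that
    by (simp add: exp_minus field_simps power2_eq_square)
  from this[of "1/t"] show "flat_exp [:0, 0, 1:] t \<le> 2"
    by (auto simp: flat_exp_def)
qed (auto simp: flat_exp_def)

context
  fixes k n :: nat and \<rho> s :: real
  assumes k: "k \<ge> 1" and n: "n \<ge> 1" and \<rho>: "\<rho> > 0" and s: "s \<ge> 0"
begin

lemma one_plus_pos: "0 < 1 + (s / \<rho>) ^ n"
  using \<rho> s by (simp add: add_pos_nonneg)

lemma rolloff_deriv:
  "(rolloff k \<rho> n has_real_derivative
     - (real k / \<rho>) * ((s / \<rho>) ^ (n - 1) / (1 + (s / \<rho>) ^ n)) * rolloff k \<rho> n s) (at s)"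
proof -
  have "((\<lambda>s. 1 + (s / \<rho>) ^ n) has_real_derivative (real n * (s / \<rho>) ^ (n - 1) / \<rho>)) (at s)"
    using \<rho> by (auto intro!: derivative_eq_intros)
  then show ?thesis
    unfolding rolloff_def[abs_def]
    by (rule DERIV_cong[OF DERIV_powr[where g = "\<lambda>s. 1 + (s / \<rho>) ^ n", OF _ one_plus_pos DERIV_const]])
      (use n one_plus_pos in \<open>simp add: mult_ac\<close>)
qed

lemma profile_has_derivative:
  "(profile k \<rho> n has_real_derivative profile_deriv k \<rho> n s) (at s)"
proof -
  have "((\<lambda>s. 1 - s / (real n)\<^sup>2) has_real_derivative - (1 / (real n)\<^sup>2)) (at s)"
    using n by (intro DERIV_cong[OF DERIV_diff[OF DERIV_const DERIV_cdivide[OF DERIV_ident]]]) simp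
  then have *: "((\<lambda>s. flat_exp 1 (1 - s / (real n)\<^sup>2)) has_real_derivative
      flat_exp [:0, 0, 1:] (1 - s / (real n)\<^sup>2) * - (1 / (real n)\<^sup>2)) (at s)"
    by (rule DERIV_cong[OF DERIV_chain2[OF flat_exp_has_derivative[of 1]]]) (simp add: pderiv_1)
  show ?thesis
    unfolding profile_def[abs_def]
    by (rule DERIV_cong[OF DERIV_mult[OF rolloff_deriv *]])
      (simp add: profile_deriv_def profile_def algebra_simps)
qed

lemma rolloff_nonneg: "0 \<le> rolloff k \<rho> n s"
  by (simp add: rolloff_def)

lemma rolloff_le_envelope: "rolloff k \<rho> n s \<le> envelope k \<rho> s"
proof (cases "s \<le> \<rho>")
  case True
  have "(1 + (s / \<rho>) ^ n) powr (- real k / real n) \<le> 1 powr (- real k / real n)"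
    using \<rho> s n by (intro powr_mono2') auto
  with True show ?thesis by (simp add: rolloff_def envelope_def)
next
  case False
  then have pos: "s / \<rho> > 0" using \<rho> by simp
  have "(1 + (s / \<rho>) ^ n) powr (- real k / real n) \<le> ((s / \<rho>) ^ n) powr (- real k / real n)"
    using pos n by (intro powr_mono2') auto
  also have "\<dots> = ((s / \<rho>) powr (real n)) powr (- real k / real n)"
    using pos by (simp add: powr_realpow)
  also have "\<dots> = (s / \<rho>) powr (- real k)"
    using n by (simp add: powr_powr)
  also have "\<dots> = (\<rho> / s) ^ k"
    using pos by (simp add: powr_minus powr_realpow power_divide)
  finally show ?thesis using False by (simp add: rolloff_def envelope_def)
qed

lemma profile_nonneg: "0 \<le> profile k \<rho> n s"
  by (simp add: profile_def rolloff_nonneg flat_exp_1_bounds)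

lemma profile_le_rolloff: "profile k \<rho> n s \<le> rolloff k \<rho> n s"
  using mult_left_mono[OF flat_exp_1_bounds(2) rolloff_nonneg] by (simp add: profile_def)

lemma abs_profile_le_envelope: "\<bar>profile k \<rho> n s\<bar> \<le> envelope k \<rho> s"
  using profile_nonneg profile_le_rolloff rolloff_le_envelope by simp

text \<open>The cutoff is a fixed function of \<open>s / n\<^sup>2\<close> that vanishes for \<open>s \<ge> n\<^sup>2\<close>, so \<open>s\<close> times its derivative is
  bounded uniformly in \<open>n\<close>.\<close>

lemma cutoff_term_bounds:
  "0 \<le> s * (flat_exp [:0, 0, 1:] (1 - s / (real n)\<^sup>2) / (real n)\<^sup>2)"
  "s * (flat_exp [:0, 0, 1:] (1 - s / (real n)\<^sup>2) / (real n)\<^sup>2) \<le> 2"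
proof -
  define t where "t = s / (real n)\<^sup>2"
  have "t * flat_exp [:0, 0, 1:] (1 - t) \<le> 1 * 2" if "t \<le> 1"
    using that by (intro mult_mono flat_exp_deriv_bounds) auto
  moreover have "flat_exp [:0, 0, 1:] (1 - t) = 0" if "t \<ge> 1"
    using that by (simp add: flat_exp_def)
  ultimately have "t * flat_exp [:0, 0, 1:] (1 - t) \<le> 2"
    by (cases "t \<le> 1") auto
  then show "s * (flat_exp [:0, 0, 1:] (1 - s / (real n)\<^sup>2) / (real n)\<^sup>2) \<le> 2"
    by (simp add: t_def)
qed (use s flat_exp_deriv_bounds in auto)

text \<open>The fraction \<open>(s/\<rho>)^n / (1 + (s/\<rho>)^n)\<close> is a smoothed step from \<open>0\<close> to \<open>1\<close> at \<open>s = \<rho>\<close>: the profile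
  passes from constant behaviour to the power law \<open>s^(-k)\<close>.\<close>

lemma times_profile_deriv:
  "s * profile_deriv k \<rho> n s =
     - real k * ((s / \<rho>) ^ n / (1 + (s / \<rho>) ^ n)) * profile k \<rho> n s
     - rolloff k \<rho> n s * (s * (flat_exp [:0, 0, 1:] (1 - s / (real n)\<^sup>2) / (real n)\<^sup>2))"
proof -
  have "s * (real k / \<rho> * (X / Y) * P) = real k * ((s / \<rho> * X) / Y) * P" for X Y P
    by simp
  moreover have "(s / \<rho>) * (s / \<rho>) ^ (n - 1) = (s / \<rho>) ^ n"
    using n by (simp flip: power_Suc)
  ultimately have "s * (real k / \<rho> * ((s / \<rho>) ^ (n - 1) / (1 + (s / \<rho>) ^ n)) * profile k \<rho> n s) =
      real k * ((s / \<rho>) ^ n / (1 + (s / \<rho>) ^ n)) * profile k \<rho> n s"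
    by metis
  then show ?thesis
    unfolding profile_deriv_def by (simp add: right_diff_distrib)
qed

lemma times_profile_deriv_le_envelope:
  "s * \<bar>profile_deriv k \<rho> n s\<bar> \<le> (real k + 2) * envelope k \<rho> s"
proof -
  let ?X = "(s / \<rho>) ^ n / (1 + (s / \<rho>) ^ n)"
  let ?Y = "s * (flat_exp [:0, 0, 1:] (1 - s / (real n)\<^sup>2) / (real n)\<^sup>2)"
  have X: "0 \<le> ?X" "?X \<le> 1"
    using one_plus_pos \<rho> s by auto
  have "s * \<bar>profile_deriv k \<rho> n s\<bar> = \<bar>s * profile_deriv k \<rho> n s\<bar>"
    using s by (simp add: abs_mult)
  also have "\<dots> \<le> real k * ?X * profile k \<rho> n s + rolloff k \<rho> n s * ?Y"
  proof -
    have "0 \<le> real k * ?X * profile k \<rho> n s" "0 \<le> rolloff k \<rho> n s * ?Y"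
      by (intro mult_nonneg_nonneg X profile_nonneg rolloff_nonneg cutoff_term_bounds of_nat_0_le_iff)+
    then show ?thesis
      unfolding times_profile_deriv by (simp add: abs_if)
  qed
  also have "\<dots> \<le> real k * 1 * envelope k \<rho> s + envelope k \<rho> s * 2"
    using X profile_nonneg rolloff_nonneg cutoff_term_bounds rolloff_le_envelope profile_le_rolloff
    by (intro add_mono mult_mono) (auto intro: order_trans)
  finally show ?thesis by (simp add: algebra_simps)
qed

end

text \<open>Inside, holomorphy of \<open>z^k p(|z|\<^sup>2)\<close> is equivalent to \<open>p' = 0\<close>; this is what holds in the limit.\<close>

lemma profile_deriv_tendsto_inside:
  assumes k: "k \<ge> 1" and \<rho>: "\<rho> > 0" and s: "0 \<le> s" "s < \<rho>"
  shows "(\<lambda>n. profile_deriv k \<rho> n s) \<longlonglongrightarrow> 0"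
proof (rule Lim_null_comparison)
  show "\<forall>\<^sub>F n in sequentially. norm (profile_deriv k \<rho> n s) \<le>
      real k / \<rho> * (s / \<rho>) ^ (n - 1) + 2 / (real n)\<^sup>2"
  proof (rule eventually_sequentiallyI[of 1])
    fix n :: nat assume n: "n \<ge> 1"
    note pr = one_plus_pos[OF k n \<rho> s(1)] rolloff_nonneg[OF k n \<rho> s(1)] rolloff_le_envelope[OF k n \<rho> s(1)]
      profile_nonneg[OF k n \<rho> s(1)] profile_le_rolloff[OF k n \<rho> s(1)]
    have le1: "rolloff k \<rho> n s \<le> 1" "profile k \<rho> n s \<le> 1"
      using pr s by (auto simp: envelope_def)
    have "(s / \<rho>) ^ (n - 1) / (1 + (s / \<rho>) ^ n) \<le> (s / \<rho>) ^ (n - 1) / 1"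
      using s \<rho> pr(1) by (intro divide_left_mono) auto
    then have "real k / \<rho> * ((s / \<rho>) ^ (n - 1) / (1 + (s / \<rho>) ^ n)) * profile k \<rho> n s
        \<le> real k / \<rho> * (s / \<rho>) ^ (n - 1) * 1"
      using pr le1 s \<rho> by (intro mult_mono mult_left_mono) auto
    moreover have "rolloff k \<rho> n s * flat_exp [:0, 0, 1:] (1 - s / (real n)\<^sup>2) / (real n)\<^sup>2 \<le> 1 * 2 / (real n)\<^sup>2"
      using le1 pr by (intro divide_right_mono mult_mono flat_exp_deriv_bounds) auto
    moreover have "0 \<le> real k / \<rho> * ((s / \<rho>) ^ (n - 1) / (1 + (s / \<rho>) ^ n)) * profile k \<rho> n s"
      "0 \<le> rolloff k \<rho> n s * flat_exp [:0, 0, 1:] (1 - s / (real n)\<^sup>2) / (real n)\<^sup>2"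
      using pr s \<rho> flat_exp_deriv_bounds by (auto intro!: mult_nonneg_nonneg divide_nonneg_nonneg)
    ultimately show "norm (profile_deriv k \<rho> n s) \<le> real k / \<rho> * (s / \<rho>) ^ (n - 1) + 2 / (real n)\<^sup>2"
      unfolding profile_deriv_def by (simp add: abs_if)
  qed
  have "(\<lambda>n. (s / \<rho>) ^ n) \<longlonglongrightarrow> 0"
    using s \<rho> by (intro LIMSEQ_power_zero) auto
  then have 1: "(\<lambda>n. (s / \<rho>) ^ (n - 1)) \<longlonglongrightarrow> 0"
    by (subst filterlim_sequentially_Suc[symmetric]) simp
  have 2: "(\<lambda>n. 2 / (real n)\<^sup>2) \<longlonglongrightarrow> 0"
    by (rule const_div_square_tendsto_0)
  show "(\<lambda>n. real k / \<rho> * (s / \<rho>) ^ (n - 1) + 2 / (real n)\<^sup>2) \<longlonglongrightarrow> 0"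
    using tendsto_add[OF tendsto_mult_right_zero[OF 1] 2] by (simp only: add_0_right)
qed

text \<open>Outside, antiholomorphy of \<open>z^k p(|z|\<^sup>2)\<close> is equivalent to \<open>k p + s p' = 0\<close>; this is what holds in the
  limit.\<close>

lemma profile_euler_tendsto_outside:
  assumes k: "k \<ge> 1" and \<rho>: "\<rho> > 0" and s: "s > \<rho>"
  shows "(\<lambda>n. real k * profile k \<rho> n s + s * profile_deriv k \<rho> n s) \<longlonglongrightarrow> 0"
proof (rule Lim_null_comparison)
  have s0: "s \<ge> 0" using \<rho> s by simp
  show "\<forall>\<^sub>F n in sequentially. norm (real k * profile k \<rho> n s + s * profile_deriv k \<rho> n s) \<le>
      real k * (\<rho> / s) ^ n + 2 * s / (real n)\<^sup>2"
  proof (rule eventually_sequentiallyI[of 1])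
    fix n :: nat assume n: "n \<ge> 1"
    note pr = one_plus_pos[OF k n \<rho> s0] rolloff_nonneg[OF k n \<rho> s0] rolloff_le_envelope[OF k n \<rho> s0]
      profile_nonneg[OF k n \<rho> s0] profile_le_rolloff[OF k n \<rho> s0]
    have "envelope k \<rho> s \<le> 1"
      using s \<rho> by (auto simp: envelope_def intro!: power_le_one)
    then have le1: "rolloff k \<rho> n s \<le> 1" "profile k \<rho> n s \<le> 1"
      using pr by auto
    have X: "(s / \<rho>) ^ n > 0" using s \<rho> by simp
    have eq: "real k * profile k \<rho> n s + s * profile_deriv k \<rho> n s =
        real k * profile k \<rho> n s * (1 / (1 + (s / \<rho>) ^ n))
        - rolloff k \<rho> n s * (s * (flat_exp [:0, 0, 1:] (1 - s / (real n)\<^sup>2) / (real n)\<^sup>2))"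
    proof -
      have "a * p + (- a * (X / (1 + X)) * p - r) = a * p * (1 / (1 + X)) - r"
        if "1 + X > 0" for a p r X :: real
        using that by (simp add: field_simps)
      from this[OF pr(1)] show ?thesis
        unfolding times_profile_deriv[OF k n \<rho> s0] .
    qed
    have "1 / (1 + (s / \<rho>) ^ n) \<le> 1 / (s / \<rho>) ^ n"
      using X by (intro divide_left_mono) auto
    also have "\<dots> = (\<rho> / s) ^ n"
      by (simp add: power_divide)
    finally have "real k * profile k \<rho> n s * (1 / (1 + (s / \<rho>) ^ n)) \<le> real k * 1 * (\<rho> / s) ^ n"
      using pr le1 by (intro mult_mono mult_left_mono) auto
    moreover have "rolloff k \<rho> n s * (s * (flat_exp [:0, 0, 1:] (1 - s / (real n)\<^sup>2) / (real n)\<^sup>2))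
        \<le> 1 * (s * (2 / (real n)\<^sup>2))"
      using le1 pr s0 by (intro divide_right_mono mult_mono mult_left_mono flat_exp_deriv_bounds
         mult_nonneg_nonneg divide_nonneg_nonneg) auto
    moreover have "0 \<le> real k * profile k \<rho> n s * (1 / (1 + (s / \<rho>) ^ n))"
      "0 \<le> rolloff k \<rho> n s * (s * (flat_exp [:0, 0, 1:] (1 - s / (real n)\<^sup>2) / (real n)\<^sup>2))"
      using pr s0 flat_exp_deriv_bounds by (auto intro!: mult_nonneg_nonneg divide_nonneg_nonneg)
    moreover have "real k * 1 * (\<rho> / s) ^ n = real k * (\<rho> / s) ^ n"
      "1 * (s * (2 / (real n)\<^sup>2)) = 2 * s / (real n)\<^sup>2" by simp_all
    ultimately show "norm (real k * profile k \<rho> n s + s * profile_deriv k \<rho> n s) \<le>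
        real k * (\<rho> / s) ^ n + 2 * s / (real n)\<^sup>2"
      unfolding eq real_norm_def by linarith
  qed
  have 1: "(\<lambda>n. (\<rho> / s) ^ n) \<longlonglongrightarrow> 0"
    using s \<rho> by (intro LIMSEQ_power_zero) auto
  have 2: "(\<lambda>n. 2 * s / (real n)\<^sup>2) \<longlonglongrightarrow> 0"
    by (rule const_div_square_tendsto_0)
  show "(\<lambda>n. real k * (\<rho> / s) ^ n + 2 * s / (real n)\<^sup>2) \<longlonglongrightarrow> 0"
    using tendsto_add[OF tendsto_mult_right_zero[OF 1] 2] by (simp only: add_0_right)
qed

text \<open>Only nonvanishing of the limit at the source radius matters, so the crude estimate
  \<open>1 + (s/\<rho>)^n \<le> (2s/\<rho>)^n\<close> replaces the computation of the limit. The factor \<open>exp(-2)\<close> comes from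
  evaluating the cutoff at an argument above \<open>1/2\<close>.\<close>

lemma profile_lower_bound:
  assumes k: "k \<ge> 1" and \<rho>: "\<rho> > 0" and s: "s > \<rho>"
  shows "\<forall>\<^sub>F n in sequentially. (\<rho> / (2 * s)) ^ k * exp (- 2) \<le> profile k \<rho> n s"
proof -
  have s0: "s \<ge> 0" using \<rho> s by simp
  have "(\<lambda>n. s / (real n)\<^sup>2) \<longlonglongrightarrow> 0" by (rule const_div_square_tendsto_0)
  then have "\<forall>\<^sub>F n in sequentially. s / (real n)\<^sup>2 < 1 / 2"
    by (rule order_tendstoD) simp
  then show ?thesis
    using eventually_ge_at_top[of 1]
  proof eventually_elim
    case (elim n)
    have pos: "2 * (s / \<rho>) > 0" and one: "s / \<rho> \<ge> 1" using s \<rho> by auto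
    have "1 + (s / \<rho>) ^ n \<le> 2 * (s / \<rho>) ^ n"
      using one_le_power[OF one, of n] by simp
    also have "\<dots> \<le> 2 ^ n * (s / \<rho>) ^ n"
      using elim one self_le_power[of 2 n] by (intro mult_right_mono) auto
    also have "\<dots> = (2 * (s / \<rho>)) ^ n"
      by (rule power_mult_distrib[symmetric])
    finally have "((2 * (s / \<rho>)) ^ n) powr (- real k / real n) \<le> rolloff k \<rho> n s"
      unfolding rolloff_def using one_plus_pos[OF k elim(2) \<rho> s0] by (intro powr_mono2') auto
    also have "((2 * (s / \<rho>)) ^ n) powr (- real k / real n) = ((2 * (s / \<rho>)) powr real n) powr (- real k / real n)"
      using pos by (simp add: powr_realpow)
    also have "\<dots> = (2 * (s / \<rho>)) powr (- real k)"
      using elim by (simp add: powr_powr)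
    also have "\<dots> = (\<rho> / (2 * s)) ^ k"
      using pos by (simp add: powr_minus powr_realpow power_divide power_mult_distrib)
    finally have 1: "(\<rho> / (2 * s)) ^ k \<le> rolloff k \<rho> n s" .
    have "exp (- 2) \<le> exp (- (1 / (1 - s / (real n)\<^sup>2)))"
    proof -
      have "1 / u \<le> 2" if "u > 1 / 2" for u :: real
        using that by (simp add: field_simps)
      from this[of "1 - s / (real n)\<^sup>2"] show ?thesis using elim by simp
    qed
    then have "exp (- 2) \<le> flat_exp 1 (1 - s / (real n)\<^sup>2)"
      using elim s0 by (auto simp: flat_exp_def)
    with 1 show ?case
      unfolding profile_def using s0 \<rho> by (intro mult_mono) (auto simp: rolloff_def)
  qed
qed

lemma profile_eq_0: "s \<ge> (real n)\<^sup>2 \<Longrightarrow> n \<ge> 1 \<Longrightarrow> profile k \<rho> n s = 0"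
  by (simp add: profile_def flat_exp_def)

section \<open>Regularised plasmon waves in the plane\<close>

definition to_complex :: "real ^ 2 \<Rightarrow> complex" where
  "to_complex x = Complex (x $ 1) (x $ 2)"

lemma norm_square_vec2: "(norm (x :: real ^ 2))\<^sup>2 = (x $ 1)\<^sup>2 + (x $ 2)\<^sup>2"
  unfolding power2_norm_eq_inner inner_vec_def by (simp add: sum_2 power2_eq_square)

lemma bounded_linear_to_complex: "bounded_linear to_complex"
proof -
  have "linear to_complex"
    by (rule linearI) (auto simp: to_complex_def complex_eq_iff)
  then show ?thesis by (rule linear_conv_bounded_linear[THEN iffD1])
qed

lemma norm_to_complex: "norm (to_complex x) = norm x"
proof -
  have "(norm (to_complex x))\<^sup>2 = (norm x)\<^sup>2"
    by (simp add: norm_square_vec2 to_complex_def cmod_power2)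
  then show ?thesis by simp
qed

definition mode :: "nat \<Rightarrow> complex \<Rightarrow> real ^ 2 \<Rightarrow> complex" where
  "mode k w x = w * to_complex x ^ k"

text \<open>The complex derivative of \<open>w z^k\<close>.\<close>

definition mode_deriv :: "nat \<Rightarrow> complex \<Rightarrow> real ^ 2 \<Rightarrow> complex" where
  "mode_deriv k w x = w * (of_nat k * to_complex x ^ (k - 1))"

definition plasmon :: "nat \<Rightarrow> real \<Rightarrow> nat \<Rightarrow> complex \<Rightarrow> real ^ 2 \<Rightarrow> complex" where
  "plasmon k \<rho> n w x = of_real (profile k \<rho> n ((norm x)\<^sup>2)) * mode k w x"

lemma mode_has_derivative:
  "(mode k w has_derivative (\<lambda>v. mode_deriv k w x * to_complex v)) (at x)"
proof -
  have "((\<lambda>z. w * z ^ k) has_field_derivative w * (of_nat k * to_complex x ^ (k - 1))) (at (to_complex x))"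
    by (auto intro!: derivative_eq_intros)
  from has_derivative_compose[OF bounded_linear_imp_has_derivative[OF bounded_linear_to_complex]
      this[unfolded has_field_derivative_def]]
  show ?thesis by (simp add: mode_def[abs_def] mode_deriv_def)
qed

text \<open>Euler's identity for the homogeneous function \<open>w z^k\<close>.\<close>

lemma of_nat_times_mode:
  assumes "k \<ge> 1"
  shows "of_nat k * mode k w x = to_complex x * mode_deriv k w x"
proof -
  have "to_complex x * to_complex x ^ (k - 1) = to_complex x ^ k"
    using assms by (simp flip: power_Suc)
  then show ?thesis by (simp add: mode_def mode_deriv_def algebra_simps)
qed

lemma plasmon_has_derivative:
  assumes "k \<ge> 1" "n \<ge> 1" "\<rho> > 0"
  shows "(plasmon k \<rho> n w has_derivative
    (\<lambda>v. of_real (profile k \<rho> n ((norm x)\<^sup>2)) * (mode_deriv k w x * to_complex v)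
       + of_real (profile_deriv k \<rho> n ((norm x)\<^sup>2) * (2 * (x \<bullet> v))) * mode k w x)) (at x)"
proof -
  have "((\<lambda>x. (norm x)\<^sup>2) has_derivative (\<lambda>v. 2 * (x \<bullet> v))) (at x)"
    unfolding power2_norm_eq_inner by (auto intro!: derivative_eq_intros simp: inner_commute)
  from has_derivative_compose[OF this
      profile_has_derivative[OF assms zero_le_power2, unfolded has_field_derivative_def]]
  have "((\<lambda>x. profile k \<rho> n ((norm x)\<^sup>2)) has_derivative
      (\<lambda>v. profile_deriv k \<rho> n ((norm x)\<^sup>2) * (2 * (x \<bullet> v)))) (at x)" .
  from has_derivative_of_real[OF this]
  show ?thesis
    unfolding plasmon_def[abs_def]
    by (rule has_derivative_mult) (rule mode_has_derivative)
qed

lemma partial_derivs_plasmon: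
  assumes "k \<ge> 1" "n \<ge> 1" "\<rho> > 0"
  defines "s \<equiv> \<lambda>x :: real ^ 2. (norm x)\<^sup>2"
  shows "partial_deriv 1 (\<lambda>x. Re (plasmon k \<rho> n w x)) x =
      profile k \<rho> n (s x) * Re (mode_deriv k w x) + 2 * profile_deriv k \<rho> n (s x) * x $ 1 * Re (mode k w x)"
    and "partial_deriv 2 (\<lambda>x. Re (plasmon k \<rho> n w x)) x =
      - profile k \<rho> n (s x) * Im (mode_deriv k w x) + 2 * profile_deriv k \<rho> n (s x) * x $ 2 * Re (mode k w x)"
    and "partial_deriv 1 (\<lambda>x. Im (plasmon k \<rho> n w x)) x =
      profile k \<rho> n (s x) * Im (mode_deriv k w x) + 2 * profile_deriv k \<rho> n (s x) * x $ 1 * Im (mode k w x)"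
    and "partial_deriv 2 (\<lambda>x. Im (plasmon k \<rho> n w x)) x =
      profile k \<rho> n (s x) * Re (mode_deriv k w x) + 2 * profile_deriv k \<rho> n (s x) * x $ 2 * Im (mode k w x)"
proof -
  have "axis i (1 :: real) $ j = (if j = i then 1 else 0)" for i j :: 2
    by (simp add: axis_def)
  then show "partial_deriv 1 (\<lambda>x. Re (plasmon k \<rho> n w x)) x =
      profile k \<rho> n (s x) * Re (mode_deriv k w x) + 2 * profile_deriv k \<rho> n (s x) * x $ 1 * Re (mode k w x)"
    "partial_deriv 2 (\<lambda>x. Re (plasmon k \<rho> n w x)) x =
      - profile k \<rho> n (s x) * Im (mode_deriv k w x) + 2 * profile_deriv k \<rho> n (s x) * x $ 2 * Re (mode k w x)"
    "partial_deriv 1 (\<lambda>x. Im (plasmon k \<rho> n w x)) x =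
      profile k \<rho> n (s x) * Im (mode_deriv k w x) + 2 * profile_deriv k \<rho> n (s x) * x $ 1 * Im (mode k w x)"
    "partial_deriv 2 (\<lambda>x. Im (plasmon k \<rho> n w x)) x =
      profile k \<rho> n (s x) * Re (mode_deriv k w x) + 2 * profile_deriv k \<rho> n (s x) * x $ 2 * Im (mode k w x)"
  using plasmon_has_derivative[OF assms(1-3), of w x, THEN bounded_linear.has_derivative[OF bounded_linear_Re],
      THEN has_derivative_imp_partial_deriv]
    plasmon_has_derivative[OF assms(1-3), of w x, THEN bounded_linear.has_derivative[OF bounded_linear_Im],
      THEN has_derivative_imp_partial_deriv]
    by (simp_all add: s_def to_complex_def inner_axis)
qed

lemma smooth_mode: "smooth (\<lambda>x. Re (mode k w x))" "smooth (\<lambda>x. Im (mode k w x))"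
proof (induction k)
  case 0
  show "smooth (\<lambda>x. Re (mode 0 w x))" "smooth (\<lambda>x. Im (mode 0 w x))"
    by (simp_all add: mode_def smooth_const)
next
  case (Suc k)
  have Re: "Re (mode (Suc k) w x) = Re (mode k w x) * x $ 1 + (- 1) * (Im (mode k w x) * x $ 2)"
    and Im: "Im (mode (Suc k) w x) = Re (mode k w x) * x $ 2 + Im (mode k w x) * x $ 1" for x
    by (simp_all add: mode_def to_complex_def algebra_simps)
  show "smooth (\<lambda>x. Re (mode (Suc k) w x))"
    unfolding Re by (intro smooth_add smooth_mult Suc smooth_component smooth_const)
  show "smooth (\<lambda>x. Im (mode (Suc k) w x))"
    unfolding Im by (intro smooth_add smooth_mult Suc smooth_component smooth_const)
qed

lemma smooth_profile:
  assumes "\<rho> > 0"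
  shows "smooth (\<lambda>x :: real ^ 2. profile k \<rho> n ((norm x)\<^sup>2))"
proof -
  have s: "smooth (\<lambda>x :: real ^ 2. (norm x)\<^sup>2)"
    unfolding norm_square_vec2 by (intro smooth_add smooth_power smooth_component)
  have "smooth (\<lambda>x :: real ^ 2. (1 + (1 / \<rho> * (norm x)\<^sup>2) ^ n) powr (- real k / real n))"
    using assms
    by (intro smooth_compose[OF smooth_on_powr] smooth_add smooth_const smooth_power smooth_mult s)
       (auto intro: add_pos_nonneg)
  moreover have "smooth (\<lambda>x :: real ^ 2. flat_exp 1 (1 + (- 1 / (real n)\<^sup>2) * (norm x)\<^sup>2))"
    by (intro smooth_compose[OF smooth_on_flat_exp] smooth_add smooth_const smooth_mult s) auto
  ultimately show ?thesis
    unfolding profile_def rolloff_def using smooth_mult by fastforce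
qed

lemma smooth_plasmon:
  assumes "\<rho> > 0"
  shows "smooth (\<lambda>x. Re (plasmon k \<rho> n w x))" "smooth (\<lambda>x. Im (plasmon k \<rho> n w x))"
  using smooth_mult[OF smooth_profile[OF assms] smooth_mode(1)]
    smooth_mult[OF smooth_profile[OF assms] smooth_mode(2)]
  by (simp_all add: plasmon_def)

lemma plasmon_eq_0: "n \<ge> 1 \<Longrightarrow> norm x \<ge> real n \<Longrightarrow> plasmon k \<rho> n w x = 0"
  by (simp add: plasmon_def profile_eq_0 power_mono)

text \<open>The gradient of the exact plasmon is of size \<open>|x|^(k-1)\<close> inside and \<open>|x|^(-k-1)\<close> outside. Since \<open>k \<ge> 1\<close>,
  both are dominated by \<open>1 / (1 + |x|\<^sup>2)\<close>, which is square integrable in the plane.\<close>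

lemma mode_deriv_envelope_le:
  assumes "k \<ge> 1" "R > 0"
  shows "norm (mode_deriv k w x) * envelope k (R\<^sup>2) ((norm x)\<^sup>2) \<le>
    norm w * real k * R ^ (k - 1) * (1 + R\<^sup>2) * (1 / (1 + (norm x)\<^sup>2))"
proof -
  obtain m where k: "k = Suc m" using assms(1) by (cases k) auto
  define r where "r = norm x"
  have r: "r \<ge> 0" by (simp add: r_def)
  have "r ^ m * envelope k (R\<^sup>2) (r\<^sup>2) * (1 + r\<^sup>2) \<le> R ^ m * (1 + R\<^sup>2)"
  proof (cases "r \<le> R")
    case True
    then have "r\<^sup>2 \<le> R\<^sup>2" using r by (intro power_mono)
    then show ?thesis
      using True r by (auto simp: envelope_def intro!: mult_mono power_mono)
  next
    case False
    define t where "t = R / r"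
    have t: "0 < t" "t \<le> 1" "r * t = R" using False assms(2) by (auto simp: t_def)
    have "R\<^sup>2 < r\<^sup>2" using False assms(2) by (intro power_strict_mono) auto
    then have "r ^ m * envelope k (R\<^sup>2) (r\<^sup>2) * (1 + r\<^sup>2) = r ^ m * (t\<^sup>2) ^ Suc m * (1 + r\<^sup>2)"
      by (simp add: envelope_def t_def power_divide k)
    also have "\<dots> = (r * t) ^ m * (t ^ m * (t\<^sup>2 + (r * t)\<^sup>2))"
      by (simp add: power_mult_distrib algebra_simps power2_eq_square)
    also have "\<dots> \<le> R ^ m * (1 * (1 + R\<^sup>2))"
      unfolding t(3) using t assms(2)
      by (intro mult_left_mono mult_mono add_mono power_le_one) (auto simp: power_le_one)
    finally show ?thesis by simp
  qed
  then have "r ^ m * envelope k (R\<^sup>2) (r\<^sup>2) \<le> R ^ m * (1 + R\<^sup>2) / (1 + r\<^sup>2)"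
    by (simp add: pos_le_divide_eq add_pos_nonneg)
  then have "norm w * real k * (r ^ m * envelope k (R\<^sup>2) (r\<^sup>2)) \<le>
      norm w * real k * (R ^ m * (1 + R\<^sup>2) / (1 + r\<^sup>2))"
    by (intro mult_left_mono) auto
  moreover have "norm (mode_deriv k w x) = norm w * real k * r ^ m"
    unfolding mode_deriv_def norm_mult norm_power norm_to_complex norm_of_nat by (simp add: k r_def)
  ultimately show ?thesis
    by (simp add: r_def[symmetric] k mult_ac)
qed

text \<open>The bound is uniform in \<open>n\<close>, which makes dominated convergence available. The term that contains
  \<open>p'\<close> is controlled through \<open>s |p'|\<close>, because \<open>k |z^k| = |z| |(z^k)'|\<close> supplies the missing factor \<open>|x|\<close>.\<close>

lemma partial_derivs_plasmon_bound:
  fixes w :: complex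
  assumes k: "k \<ge> 1" and n: "n \<ge> 1" and R: "R > 0"
  defines "C \<equiv> (2 * real k + 5) * (norm w * real k * R ^ (k - 1) * (1 + R\<^sup>2))"
  shows "\<bar>partial_deriv i (\<lambda>x. Re (plasmon k (R\<^sup>2) n w x)) x\<bar> \<le> C * (1 / (1 + (norm x)\<^sup>2))"
    and "\<bar>partial_deriv i (\<lambda>x. Im (plasmon k (R\<^sup>2) n w x)) x\<bar> \<le> C * (1 / (1 + (norm x)\<^sup>2))"
proof -
  have \<rho>: "R\<^sup>2 > 0" using R by simp
  define s where "s = (norm x)\<^sup>2"
  have s: "s \<ge> 0" by (simp add: s_def)
  define p p' e H h where d: "p = profile k (R\<^sup>2) n s" "p' = profile_deriv k (R\<^sup>2) n s"
    "e = envelope k (R\<^sup>2) s" "H = mode_deriv k w x" "h = mode k w x"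
  have h: "real k * norm h = norm x * norm H"
    using arg_cong[OF of_nat_times_mode[OF k, of w x], of norm] by (simp add: norm_mult d norm_to_complex)
  have "norm x * \<bar>p'\<bar> * norm h \<le> real k * (norm x * \<bar>p'\<bar> * norm h)"
    using k mult_right_mono[of 1 "real k" "norm x * \<bar>p'\<bar> * norm h"] by simp
  also have "\<dots> = norm x * \<bar>p'\<bar> * (real k * norm h)" by simp
  also have "\<dots> = s * \<bar>p'\<bar> * norm H" by (simp add: h s_def power2_eq_square)
  also have "\<dots> \<le> (real k + 2) * e * norm H"
    using times_profile_deriv_le_envelope[OF k n \<rho> s] by (intro mult_right_mono) (simp_all add: d)
  finally have ph: "norm x * \<bar>p'\<bar> * norm h \<le> (real k + 2) * e * norm H" .
  have gen: "\<bar>p * a + 2 * p' * x $ i * b\<bar> \<le> C * (1 / (1 + (norm x)\<^sup>2))"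
    if "\<bar>a\<bar> \<le> norm H" "\<bar>b\<bar> \<le> norm h" for a b i
  proof -
    have "\<bar>p * a + 2 * p' * x $ i * b\<bar> \<le> \<bar>p\<bar> * \<bar>a\<bar> + 2 * (\<bar>x $ i\<bar> * \<bar>p'\<bar> * \<bar>b\<bar>)"
      using abs_triangle_ineq[of "p * a" "2 * p' * x $ i * b"] by (simp add: abs_mult mult_ac)
    also have "\<dots> \<le> e * norm H + 2 * (norm x * \<bar>p'\<bar> * norm h)"
      using that abs_profile_le_envelope[OF k n \<rho> s]
      by (intro add_mono mult_mono mult_left_mono component_le_norm_cart) (auto simp: d)
    also have "\<dots> \<le> e * norm H + 2 * ((real k + 2) * e * norm H)"
      using ph by simp
    also have "\<dots> = (2 * real k + 5) * (norm H * e)"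
      by (simp add: algebra_simps)
    also have "\<dots> \<le> (2 * real k + 5) *
        (norm w * real k * R ^ (k - 1) * (1 + R\<^sup>2) * (1 / (1 + (norm x)\<^sup>2)))"
      using mode_deriv_envelope_le[OF k R, of w x] by (intro mult_left_mono) (auto simp: d s_def)
    finally show ?thesis by (simp add: C_def mult.assoc)
  qed
  note pd = partial_derivs_plasmon[OF k n \<rho>, of w x, folded s_def, folded d]
  have i: "i = 1 \<or> i = 2" using UNIV_2 by auto
  show "\<bar>partial_deriv i (\<lambda>x. Re (plasmon k (R\<^sup>2) n w x)) x\<bar> \<le> C * (1 / (1 + (norm x)\<^sup>2))"
  proof -
    have "\<bar>p * Re H + 2 * p' * x $ 1 * Re h\<bar> \<le> C * (1 / (1 + (norm x)\<^sup>2))"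
      by (intro gen abs_Re_le_cmod)
    moreover have "\<bar>p * - Im H + 2 * p' * x $ 2 * Re h\<bar> \<le> C * (1 / (1 + (norm x)\<^sup>2))"
      by (intro gen) (simp_all add: abs_Re_le_cmod abs_Im_le_cmod)
    ultimately show ?thesis
      using i pd(1,2) by (elim disjE) simp_all
  qed
  show "\<bar>partial_deriv i (\<lambda>x. Im (plasmon k (R\<^sup>2) n w x)) x\<bar> \<le> C * (1 / (1 + (norm x)\<^sup>2))"
  proof -
    have "\<bar>p * Im H + 2 * p' * x $ 1 * Im h\<bar> \<le> C * (1 / (1 + (norm x)\<^sup>2))"
      by (intro gen abs_Im_le_cmod)
    moreover have "\<bar>p * Re H + 2 * p' * x $ 2 * Im h\<bar> \<le> C * (1 / (1 + (norm x)\<^sup>2))"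
      by (intro gen abs_Re_le_cmod abs_Im_le_cmod)
    ultimately show ?thesis
      using i pd(3,4) by (elim disjE) simp_all
  qed
qed

text \<open>In the limit \<open>A \<nabla>\<phi>\<close> is the rotated gradient of \<open>\<psi>\<close>: the Cauchy-Riemann equations hold with opposite
  signs on the two sides of the circle, and so does \<open>A\<close>.\<close>

lemma plasmon_flux_defect_tendsto_0:
  fixes w :: complex
  assumes k: "k \<ge> 1" and R: "R > 0" and x: "norm x \<noteq> R"
  defines "\<phi> \<equiv> \<lambda>n x. Re (plasmon k (R\<^sup>2) n w x)" and "\<psi> \<equiv> \<lambda>n x. Im (plasmon k (R\<^sup>2) n w x)"
  shows "(\<lambda>n. coreless_coeff R x * partial_deriv 1 (\<phi> n) x + partial_deriv 2 (\<psi> n) x) \<longlonglongrightarrow> 0"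
    and "(\<lambda>n. coreless_coeff R x * partial_deriv 2 (\<phi> n) x - partial_deriv 1 (\<psi> n) x) \<longlonglongrightarrow> 0"
proof -
  have \<rho>: "R\<^sup>2 > 0" using R by simp
  define s where "s = (norm x)\<^sup>2"
  have s: "s \<ge> 0" by (simp add: s_def)
  define p p' H h where d: "p = (\<lambda>n. profile k (R\<^sup>2) n s)" "p' = (\<lambda>n. profile_deriv k (R\<^sup>2) n s)"
    "H = mode_deriv k w x" "h = mode k w x"
  define E1 where "E1 n = coreless_coeff R x * partial_deriv 1 (\<phi> n) x + partial_deriv 2 (\<psi> n) x" for n
  define E2 where "E2 n = coreless_coeff R x * partial_deriv 2 (\<phi> n) x - partial_deriv 1 (\<psi> n) x" for n
  note pd = partial_derivs_plasmon[OF k _ \<rho>, of _ w x, folded s_def]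
  have ev: "E1 \<longlonglongrightarrow> 0 \<and> E2 \<longlonglongrightarrow> 0"
    if "\<And>n. n \<ge> 1 \<Longrightarrow> E1 n = c1 * q n" "\<And>n. n \<ge> 1 \<Longrightarrow> E2 n = c2 * q n" "q \<longlonglongrightarrow> 0" for c1 c2 q
  proof -
    have "\<forall>\<^sub>F n in sequentially. E1 n = c1 * q n" "\<forall>\<^sub>F n in sequentially. E2 n = c2 * q n"
      using that(1,2) by (auto intro: eventually_sequentiallyI[of 1])
    then show ?thesis
      using tendsto_mult_right_zero[OF that(3), of c1] tendsto_mult_right_zero[OF that(3), of c2]
      by (simp add: tendsto_cong)
  qed
  have "E1 \<longlonglongrightarrow> 0 \<and> E2 \<longlonglongrightarrow> 0"
  proof (cases "norm x < R")
    case True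
    then have A: "coreless_coeff R x = - 1" by (simp add: coreless_coeff_def)
    have "s < R\<^sup>2" unfolding s_def using True by (intro power_strict_mono) auto
    then have lim: "p' \<longlonglongrightarrow> 0"
      unfolding d by (intro profile_deriv_tendsto_inside k \<rho> s)
    show ?thesis
    proof (rule ev[OF _ _ lim])
      fix n :: nat assume n: "n \<ge> 1"
      show "E1 n = 2 * (x $ 2 * Im h - x $ 1 * Re h) * p' n"
        by (simp add: E1_def \<phi>_def \<psi>_def A pd[OF n] d algebra_simps)
      show "E2 n = - 2 * (x $ 2 * Re h + x $ 1 * Im h) * p' n"
        by (simp add: E2_def \<phi>_def \<psi>_def A pd[OF n] d algebra_simps)
    qed
  next
    case False
    then have A: "coreless_coeff R x = 1" using x by (simp add: coreless_coeff_def)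
    have "s > R\<^sup>2" unfolding s_def using False x R by (intro power_strict_mono) auto
    then have lim: "(\<lambda>n. real k * p n + s * p' n) \<longlonglongrightarrow> 0"
      unfolding d by (intro profile_euler_tendsto_outside k \<rho>)
    have "to_complex x * cnj (to_complex x) = of_real s"
      using complex_norm_square[of "to_complex x"] by (simp add: s_def norm_to_complex)
    \<comment> \<open>Euler's identity turns the radial terms into multiples of the derivative, so that both
      components of the defect contain the factor \<open>k p + s p'\<close>.\<close>
    then have "cnj (to_complex x) * (of_nat k * h) = of_real s * H"
      unfolding d of_nat_times_mode[OF k] by (metis mult.assoc mult.commute)
    then have hH: "real k * (x $ 1 * Re h + x $ 2 * Im h) = s * Re H"
      "real k * (x $ 1 * Im h - x $ 2 * Re h) = s * Im H"
      by (auto simp: complex_eq_iff to_complex_def algebra_simps)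
    have k0: "real k \<noteq> 0" using k by simp
    show ?thesis
    proof (rule ev[OF _ _ lim])
      fix n :: nat assume n: "n \<ge> 1"
      have "real k * E1 n = 2 * (real k * p n * Re H + p' n * (real k * (x $ 1 * Re h + x $ 2 * Im h)))"
        by (simp add: E1_def \<phi>_def \<psi>_def A pd[OF n] d algebra_simps)
      then show "E1 n = 2 * Re H / real k * (real k * p n + s * p' n)"
        unfolding hH using k0 by (simp add: field_simps)
      have "real k * E2 n = - 2 * (real k * p n * Im H + p' n * (real k * (x $ 1 * Im h - x $ 2 * Re h)))"
        by (simp add: E2_def \<phi>_def \<psi>_def A pd[OF n] d algebra_simps)
      then show "E2 n = - 2 * Im H / real k * (real k * p n + s * p' n)"
        unfolding hH using k0 by (simp add: field_simps)
    qed
  qed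
  then show "(\<lambda>n. coreless_coeff R x * partial_deriv 1 (\<phi> n) x + partial_deriv 2 (\<psi> n) x) \<longlonglongrightarrow> 0"
    "(\<lambda>n. coreless_coeff R x * partial_deriv 2 (\<phi> n) x - partial_deriv 1 (\<psi> n) x) \<longlonglongrightarrow> 0"
    by (simp_all add: E1_def[abs_def] E2_def[abs_def])
qed

section \<open>Testing the equation with a plasmon wave\<close>

lemma support_partial_deriv:
  "{x. partial_deriv i f x \<noteq> 0} \<subseteq> closure {x. f x \<noteq> 0}"
proof (rule subsetI, rule ccontr)
  fix x assume x: "x \<in> {x. partial_deriv i f x \<noteq> 0}" "x \<notin> closure {x. f x \<noteq> 0}"
  have "0 = f y" if "y \<in> - closure {x. f x \<noteq> 0}" for y
    using that closure_subset[of "{x. f x \<noteq> 0}"] by auto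
  with x(2) have "(f has_derivative (\<lambda>_. 0)) (at x)"
    by (intro has_derivative_transform_within_open[OF has_derivative_const open_Compl[OF closed_closure]]) blast+
  then have "partial_deriv i f x = 0"
    by (rule has_derivative_imp_partial_deriv)
  with x(1) show False by simp
qed

lemma test_function_partial_deriv:
  assumes "smooth f" "compact (closure {x. f x \<noteq> 0})"
  shows "test_function (partial_deriv i f)"
proof -
  have "compact (closure {x. partial_deriv i f x \<noteq> 0})"
    using bounded_subset[OF compact_imp_bounded[OF assms(2)] support_partial_deriv]
    by (simp add: compact_closure)
  then show ?thesis
    by (simp add: test_function_def smooth_cont_diff_partial[OF assms(1)])
qed

text \<open>Apply the definition of the weak gradient to the two partial derivatives of \<open>\<psi>\<close>, which are again test
  functions, and use that mixed second derivatives commute.\<close>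

lemma weak_gradient_curl_free:
  assumes "has_weak_gradient u G" "smooth \<psi>" "compact (closure {x. \<psi> x \<noteq> 0})"
  shows "(LINT x|lebesgue. G x $ i * of_real (partial_deriv j \<psi> x)) =
         (LINT x|lebesgue. G x $ j * of_real (partial_deriv i \<psi> x))"
proof -
  have parts: "(LINT x|lebesgue. u x * of_real (partial_deriv i (partial_deriv j \<psi>) x)) =
      - (LINT x|lebesgue. G x $ i * of_real (partial_deriv j \<psi> x))" for i j
    using assms(1) test_function_partial_deriv[OF assms(2,3)] by (simp add: has_weak_gradient_def)
  have "partial_deriv i (partial_deriv j \<psi>) = partial_deriv j (partial_deriv i \<psi>)"
    using assms(2) by (simp add: smooth_def)
  with parts[of i j] parts[of j i] show ?thesis by simp
qed

lemma borel_measurable_partial_deriv: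
  assumes "smooth f"
  shows "partial_deriv i f \<in> borel_measurable lebesgue"
proof -
  have "continuous_on UNIV (partial_deriv i f)"
    using smooth_cont_diff_partial[OF assms, of 0] by simp
  then have "partial_deriv i f \<in> borel_measurable borel"
    by (rule borel_measurable_continuous_onI)
  then show ?thesis
    by (intro measurable_completion) simp
qed

text \<open>Split \<open>A \<nabla>\<phi>\<^sub>n = E\<^sub>n + (-\<partial>\<^sub>2\<psi>\<^sub>n, \<partial>\<^sub>1\<psi>\<^sub>n)\<close>. The rotated gradient does not contribute, the defect \<open>E\<^sub>n\<close>
  disappears by dominated convergence, and what remains of the equation carries the factor \<open>\<eta>\<close>.\<close>

lemma flux_estimate:
  fixes G :: "real ^ 2 \<Rightarrow> complex ^ 2" and A D :: "real ^ 2 \<Rightarrow> real"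
    and \<phi> \<psi> :: "nat \<Rightarrow> real ^ 2 \<Rightarrow> real"
  assumes grad: "has_weak_gradient u G" and G: "square_integrable lebesgue G"
    and A: "A \<in> borel_measurable lebesgue" "\<And>x. \<bar>A x\<bar> \<le> 1"
    and D: "square_integrable lebesgue D"
    and smooth: "\<And>n. smooth (\<phi> n)" "\<And>n. smooth (\<psi> n)"
    and supp: "\<And>n. compact (closure {x. \<psi> n x \<noteq> 0})"
    and dom: "\<And>n i x. \<bar>partial_deriv i (\<phi> n) x\<bar> \<le> D x" "\<And>n i x. \<bar>partial_deriv i (\<psi> n) x\<bar> \<le> D x"
    and lim: "AE x in lebesgue. (\<lambda>n. A x * partial_deriv 1 (\<phi> n) x + partial_deriv 2 (\<psi> n) x) \<longlonglongrightarrow> 0"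
      "AE x in lebesgue. (\<lambda>n. A x * partial_deriv 2 (\<phi> n) x - partial_deriv 1 (\<psi> n) x) \<longlonglongrightarrow> 0"
    and eq: "\<And>n. - (LINT x|lebesgue. (of_real (A x) + \<i> * of_real \<eta>) *
        (\<Sum>i\<in>UNIV. G x $ i * of_real (partial_deriv i (\<phi> n) x))) = of_real (f n)"
    and \<eta>: "\<eta> > 0" and c: "\<forall>\<^sub>F n in sequentially. c \<le> \<bar>f n\<bar>"
  shows "integrable lebesgue (\<lambda>x. norm (G x) * D x)"
    and "c \<le> \<eta> * (LINT x|lebesgue. 2 * (norm (G x) * D x))"
proof -
  have Gm: "(\<lambda>x. G x $ i) \<in> borel_measurable lebesgue" for i
    by (rule measurable_compose[OF _ borel_measurable_continuous_onI])
      (use G in \<open>auto simp: square_integrable_def intro!: continuous_intros\<close>)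
  have Gm': "(\<lambda>x. norm (G x)) \<in> borel_measurable lebesgue" and Dm: "D \<in> borel_measurable lebesgue"
    using G D by (auto simp: square_integrable_def)
  have D0: "D x \<ge> 0" for x using dom(1)[of undefined undefined x] by linarith
  show GD: "integrable lebesgue (\<lambda>x. norm (G x) * D x)"
  proof (rule Bochner_Integration.integrable_bound)
    show "integrable lebesgue (\<lambda>x. (norm (G x))\<^sup>2 + (norm (D x))\<^sup>2)"
      using G D by (auto simp: square_integrable_def)
    have "a * b \<le> a\<^sup>2 + b\<^sup>2" if "a \<ge> 0" "b \<ge> 0" for a b :: real
      using sum_squares_bound[of a b] mult_nonneg_nonneg[OF that] by linarith
    then show "AE x in lebesgue. norm (norm (G x) * D x) \<le> norm ((norm (G x))\<^sup>2 + (norm (D x))\<^sup>2)"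
      by (intro AE_I2) (simp add: abs_mult D0)
  qed (use Gm' Dm in measurable)
  note pdm = borel_measurable_partial_deriv[OF smooth(1)] borel_measurable_partial_deriv[OF smooth(2)]
  note [measurable] = Gm Gm' Dm A(1) pdm
  have bound: "norm (G x $ i * of_real g) \<le> K * (norm (G x) * D x)" if "\<bar>g\<bar> \<le> K * D x" "K \<ge> 0" for i x g K
    unfolding norm_mult norm_of_real
  proof -
    have "norm (G x $ i) * \<bar>g\<bar> \<le> norm (G x) * (K * D x)"
      by (intro mult_mono Finite_Cartesian_Product.norm_nth_le that(1)) auto
    then show "norm (G x $ i) * \<bar>g\<bar> \<le> K * (norm (G x) * D x)"
      by (simp add: mult_ac)
  qed
  have int: "integrable lebesgue (\<lambda>x. G x $ i * of_real (g x))"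
    if "g \<in> borel_measurable lebesgue" "\<And>x. \<bar>g x\<bar> \<le> K * D x" "K \<ge> 0" for i g K
  proof (rule Bochner_Integration.integrable_bound)
    show "integrable lebesgue (\<lambda>x. K * (norm (G x) * D x))" using GD by simp
    show "AE x in lebesgue. norm (G x $ i * of_real (g x)) \<le> norm (K * (norm (G x) * D x))"
      by (intro AE_I2 order_trans[OF bound[OF that(2,3)]]) simp
  qed (use that(1) in measurable)
  define E1 where "E1 n x = A x * partial_deriv 1 (\<phi> n) x + partial_deriv 2 (\<psi> n) x" for n x
  define E2 where "E2 n x = A x * partial_deriv 2 (\<phi> n) x - partial_deriv 1 (\<psi> n) x" for n x
  have Em: "E1 n \<in> borel_measurable lebesgue" "E2 n \<in> borel_measurable lebesgue" for n
    unfolding E1_def[abs_def] E2_def[abs_def] by measurable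
  have comb: "\<bar>A x * a + b\<bar> \<le> 2 * d" "\<bar>A x * a - b\<bar> \<le> 2 * d" if "\<bar>a\<bar> \<le> d" "\<bar>b\<bar> \<le> d" for a b d x
  proof -
    have "\<bar>A x * a\<bar> \<le> 1 * d"
      unfolding abs_mult using that A(2)[of x] by (intro mult_mono) auto
    then show "\<bar>A x * a + b\<bar> \<le> 2 * d" "\<bar>A x * a - b\<bar> \<le> 2 * d"
      using that(2) by linarith+
  qed
  have Eb: "\<bar>E1 n x\<bar> \<le> 2 * D x" "\<bar>E2 n x\<bar> \<le> 2 * D x" for n x
    unfolding E1_def E2_def by (rule comb(1)[OF dom(1) dom(2)] comb(2)[OF dom(1) dom(2)])+
  have "partial_deriv i (\<phi> n) \<in> borel_measurable lebesgue" "\<bar>partial_deriv i (\<phi> n) x\<bar> \<le> 1 * D x"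
    "partial_deriv i (\<psi> n) \<in> borel_measurable lebesgue" "\<bar>partial_deriv i (\<psi> n) x\<bar> \<le> 1 * D x" for i n x
    by (simp_all add: dom pdm)
  note ints = int[OF this(1,2) zero_le_one] int[OF this(3,4) zero_le_one] int[OF Em(1) Eb(1) zero_le_numeral] int[OF Em(2) Eb(2) zero_le_numeral]
  define I where "I n = (LINT x|lebesgue. G x $ 1 * of_real (E1 n x) + G x $ 2 * of_real (E2 n x))" for n
  define J where "J n = (LINT x|lebesgue. G x $ 1 * of_real (partial_deriv 1 (\<phi> n) x)
    + G x $ 2 * of_real (partial_deriv 2 (\<phi> n) x))" for n
  have f: "of_real (f n) = - I n - \<i> * of_real \<eta> * J n" for n
  proof -
    have i1: "integrable lebesgue (\<lambda>x. G x $ 1 * of_real (E1 n x) + G x $ 2 * of_real (E2 n x))"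
      by (intro Bochner_Integration.integrable_add ints)
    have i2: "integrable lebesgue (\<lambda>x. G x $ 1 * of_real (partial_deriv 1 (\<phi> n) x) + G x $ 2 * of_real (partial_deriv 2 (\<phi> n) x))"
      by (intro Bochner_Integration.integrable_add ints)
    have i3: "integrable lebesgue (\<lambda>x. G x $ 2 * of_real (partial_deriv 1 (\<psi> n) x) - G x $ 1 * of_real (partial_deriv 2 (\<psi> n) x))"
      by (intro Bochner_Integration.integrable_diff ints)
    have "(LINT x|lebesgue. (of_real (A x) + \<i> * of_real \<eta>) *
        (\<Sum>i\<in>UNIV. G x $ i * of_real (partial_deriv i (\<phi> n) x))) =
      (LINT x|lebesgue. (G x $ 1 * of_real (E1 n x) + G x $ 2 * of_real (E2 n x))
        + \<i> * of_real \<eta> * (G x $ 1 * of_real (partial_deriv 1 (\<phi> n) x) + G x $ 2 * of_real (partial_deriv 2 (\<phi> n) x))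
        + (G x $ 2 * of_real (partial_deriv 1 (\<psi> n) x) - G x $ 1 * of_real (partial_deriv 2 (\<psi> n) x)))"
      (is "_ = ?split")
      by (intro Bochner_Integration.integral_cong) (auto simp: sum_2 E1_def E2_def algebra_simps)
    also have "?split = I n + \<i> * of_real \<eta> * J n
        + (LINT x|lebesgue. G x $ 2 * of_real (partial_deriv 1 (\<psi> n) x) - G x $ 1 * of_real (partial_deriv 2 (\<psi> n) x))"
      unfolding I_def J_def
      by (simp only: Bochner_Integration.integral_add[OF Bochner_Integration.integrable_add[OF i1 integrable_mult_right[OF i2]] i3]
          Bochner_Integration.integral_add[OF i1 integrable_mult_right[OF i2]] integral_mult_right_zero)
    also have "(LINT x|lebesgue. G x $ 2 * of_real (partial_deriv 1 (\<psi> n) x) - G x $ 1 * of_real (partial_deriv 2 (\<psi> n) x)) = 0"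
      using ints weak_gradient_curl_free[OF grad smooth(2) supp, of 2 1] by simp
    finally show ?thesis using eq[of n] by (simp add: algebra_simps)
  qed
  have I: "I \<longlonglongrightarrow> 0"
  proof -
    have "(\<lambda>n. I n) \<longlonglongrightarrow> (LINT x|(lebesgue :: (real ^ 2) measure). (0 :: complex))"
      unfolding I_def
    proof (rule integral_dominated_convergence[where w = "\<lambda>x. 4 * (norm (G x) * D x)"])
      show "AE x in lebesgue. (\<lambda>n. G x $ 1 * of_real (E1 n x) + G x $ 2 * of_real (E2 n x)) \<longlonglongrightarrow> 0"
        using lim
      proof eventually_elim
        case (elim x)
        then have "(\<lambda>n. G x $ 1 * of_real (E1 n x) + G x $ 2 * of_real (E2 n x)) \<longlonglongrightarrow> G x $ 1 * of_real 0 + G x $ 2 * of_real 0"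
          unfolding E1_def E2_def by (intro tendsto_intros)
        then show ?case by simp
      qed
      show "AE x in lebesgue. norm (G x $ 1 * of_real (E1 n x) + G x $ 2 * of_real (E2 n x)) \<le> 4 * (norm (G x) * D x)" for n
      proof (rule AE_I2)
        fix x
        show "norm (G x $ 1 * of_real (E1 n x) + G x $ 2 * of_real (E2 n x)) \<le> 4 * (norm (G x) * D x)"
          using norm_triangle_ineq[of "G x $ 1 * of_real (E1 n x)" "G x $ 2 * of_real (E2 n x)"]
            bound[OF Eb(1)[of n x], of 1] bound[OF Eb(2)[of n x], of 2] by simp
      qed
    qed (use GD Em in \<open>auto\<close>)
    then show ?thesis by simp
  qed
  have J: "norm (J n) \<le> (LINT x|lebesgue. 2 * (norm (G x) * D x))" for n
    unfolding J_def
  proof (rule Bochner_Integration.integral_norm_bound_integral)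
    fix x
    show "norm (G x $ 1 * of_real (partial_deriv 1 (\<phi> n) x) + G x $ 2 * of_real (partial_deriv 2 (\<phi> n) x))
        \<le> 2 * (norm (G x) * D x)"
      using norm_triangle_ineq[of "G x $ 1 * of_real (partial_deriv 1 (\<phi> n) x)" "G x $ 2 * of_real (partial_deriv 2 (\<phi> n) x)"]
        bound[of "partial_deriv 1 (\<phi> n) x" 1 x 1] bound[of "partial_deriv 2 (\<phi> n) x" 1 x 2] dom(1)[of _ n x] by simp
  qed (use GD ints in auto)
  have "\<forall>\<^sub>F n in sequentially. c \<le> norm (I n) + \<eta> * (LINT x|lebesgue. 2 * (norm (G x) * D x))"
    using c
  proof eventually_elim
    case (elim n)
    have "\<bar>f n\<bar> = norm (complex_of_real (f n))" by simp
    also have "\<dots> \<le> norm (I n) + \<eta> * norm (J n)"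
      unfolding f using norm_triangle_ineq4[of "- I n" "\<i> * of_real \<eta> * J n"] \<eta> by (simp add: norm_mult)
    also have "\<dots> \<le> norm (I n) + \<eta> * (LINT x|lebesgue. 2 * (norm (G x) * D x))"
      using J[of n] \<eta> by simp
    finally show ?case using elim by simp
  qed
  moreover have "(\<lambda>n. norm (I n) + \<eta> * (LINT x|lebesgue. 2 * (norm (G x) * D x))) \<longlonglongrightarrow>
      0 + \<eta> * (LINT x|lebesgue. 2 * (norm (G x) * D x))"
    using tendsto_norm_zero[OF I] by (intro tendsto_intros)
  ultimately show "c \<le> \<eta> * (LINT x|lebesgue. 2 * (norm (G x) * D x))"
    using tendsto_lowerbound[of _ _ sequentially c] by auto
qed

section \<open>One-dimensional Hausdorff measure of a circle\<close>

text \<open>If the outer measure is countably additive on the Borel sets, the two sides agree for Borel \<open>X\<close>; in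
  every other case \<open>emeasure\<close> is zero by convention. Upper bounds for lengths thus follow from coverings.\<close>

lemma emeasure_hausdorff1_le: "emeasure hausdorff1 X \<le> hausdorff1_outer X"
  unfolding hausdorff1_def by (simp add: emeasure_measure_of_conv)

lemma space_hausdorff1 [simp]: "space hausdorff1 = UNIV"
  by (simp add: hausdorff1_def space_measure_of_conv)

lemma sets_hausdorff1 [simp]: "sets hausdorff1 = sets borel"
  unfolding hausdorff1_def using sets.sigma_sets_eq[of borel] by (simp add: sets_measure_of_conv)

text \<open>Cut the parameter interval into \<open>N\<close> equal pieces; their images have diameter at most \<open>L / N\<close>.\<close>

lemma hausdorff1_outer_lipschitz_image_le:
  fixes \<gamma> :: "real \<Rightarrow> 'a::metric_space"
  assumes L: "L \<ge> 0" and lip: "\<And>s t. dist (\<gamma> s) (\<gamma> t) \<le> L * \<bar>s - t\<bar>"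
  shows "hausdorff1_outer (\<gamma> ` {0..<1}) \<le> ennreal L"
  unfolding hausdorff1_outer_def
proof (rule SUP_least)
  fix \<delta> :: real assume "\<delta> \<in> {0<..}"
  then have \<delta>: "\<delta> > 0" by simp
  obtain N :: nat where N: "real N > L / \<delta>" using reals_Archimedean2 by blast
  then have N0: "real N > 0" using L \<delta> by (meson divide_nonneg_pos le_less_trans)
  define C where "C i = (if i < N then \<gamma> ` {real i / N .. (real i + 1) / N} else {})" for i
  have dist: "dist x y \<le> L / N" if "x \<in> C i" "y \<in> C i" for x y i
  proof -
    have "x \<in> \<gamma> ` {real i / N .. (real i + 1) / N}" "y \<in> \<gamma> ` {real i / N .. (real i + 1) / N}"
      using that by (auto simp: C_def split: if_splits)
    then obtain s t where st: "x = \<gamma> s" "y = \<gamma> t" "s \<in> {real i / N .. (real i + 1) / N}" "t \<in> {real i / N .. (real i + 1) / N}"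
      by (elim imageE)
    then have "\<bar>s - t\<bar> \<le> 1 / N"
      by (auto simp: abs_le_iff add_divide_distrib)
    then have "L * \<bar>s - t\<bar> \<le> L * (1 / N)"
      using L by (intro mult_left_mono)
    then show ?thesis using lip[of s t] st by simp
  qed
  have diam: "diameter (C i) \<le> L / N" for i
  proof (cases "C i = {}")
    case False
    then show ?thesis unfolding diameter_def using dist by (auto intro!: cSUP_least)
  qed (use L N0 in \<open>auto simp: diameter_def\<close>)
  have "bounded (C i)" for i
    using dist unfolding bounded_two_points by blast
  moreover have "L / N \<le> \<delta>"
    using N N0 \<delta> by (simp add: field_simps)
  moreover have "\<gamma> ` {0..<1} \<subseteq> (\<Union>i. C i)"
  proof
    fix x assume "x \<in> \<gamma> ` {0..<1}"
    then obtain t where t: "x = \<gamma> t" "0 \<le> t" "t < 1" by auto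
    define i where "i = nat \<lfloor>t * N\<rfloor>"
    have i: "real i \<le> t * N" "t * N < real i + 1"
      using t N0 unfolding i_def by (simp_all add: of_nat_nat)
    have "t * real N < 1 * real N" using t N0 by (intro mult_strict_right_mono)
    with i have "real i < real N" by linarith
    with i t N0 show "x \<in> (\<Union>i. C i)"
      by (auto simp: C_def field_simps intro!: exI[of _ i] imageI)
  qed
  ultimately have "C \<in> {C. \<gamma> ` {0..<1} \<subseteq> (\<Union>i. C i) \<and> (\<forall>i. bounded (C i) \<and> diameter (C i) \<le> \<delta>)}"
    using order_trans[OF diam] by blast
  then have "hausdorff1_pre \<delta> (\<gamma> ` {0..<1}) \<le> (\<Sum>i. ennreal (diameter (C i)))"
    unfolding hausdorff1_pre_def by (rule INF_lower)
  also have "\<dots> = (\<Sum>i<N. ennreal (diameter (C i)))"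
    by (rule suminf_finite) (auto simp: C_def)
  also have "\<dots> \<le> (\<Sum>i<N. ennreal (L / N))"
    by (intro sum_mono ennreal_leI diam)
  also have "\<dots> = ennreal L"
    using N0 L by (simp add: ennreal_of_nat_eq_real_of_nat flip: ennreal_mult)
  finally show "hausdorff1_pre \<delta> (\<gamma> ` {0..<1}) \<le> ennreal L" .
qed

lemma abs_cos_diff_le: "\<bar>cos s - cos t\<bar> \<le> \<bar>s - t\<bar>" for s t :: real
proof -
  have "\<bar>cos s - cos t\<bar> = 2 * (\<bar>sin ((s + t) / 2)\<bar> * \<bar>sin ((t - s) / 2)\<bar>)"
    by (simp add: cos_diff_cos abs_mult)
  also have "\<dots> \<le> 2 * (1 * \<bar>(t - s) / 2\<bar>)"
    by (intro mult_left_mono mult_mono abs_sin_x_le_abs_x abs_sin_le_one) auto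
  finally show ?thesis by simp
qed

lemma abs_sin_diff_le: "\<bar>sin s - sin t\<bar> \<le> \<bar>s - t\<bar>" for s t :: real
  using abs_cos_diff_le[of "pi / 2 - s" "pi / 2 - t"] by (simp add: cos_diff abs_minus_commute)

lemma hausdorff1_outer_mono: "X \<subseteq> Y \<Longrightarrow> hausdorff1_outer X \<le> hausdorff1_outer Y"
  unfolding hausdorff1_outer_def hausdorff1_pre_def
  by (intro SUP_mono' INF_superset_mono) auto

text \<open>A Lipschitz constant that is not sharp suffices; the sum of the absolute components bounds the
  distance.\<close>

lemma emeasure_hausdorff1_circle_finite:
  fixes q :: real
  assumes "q > 0"
  shows "emeasure hausdorff1 (sphere (0 :: real ^ 2) q) < \<infinity>"
proof -
  define \<gamma> :: "real \<Rightarrow> real ^ 2" where "\<gamma> t = vector [q * cos (2 * pi * t), q * sin (2 * pi * t)]" for t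
  have "sphere 0 q \<subseteq> \<gamma> ` {0..<1}"
  proof
    fix x :: "real ^ 2" assume "x \<in> sphere 0 q"
    then have "(x $ 1)\<^sup>2 + (x $ 2)\<^sup>2 = q\<^sup>2"
      by (simp add: norm_square_vec2[symmetric])
    then have "(x $ 1 / q)\<^sup>2 + (x $ 2 / q)\<^sup>2 = 1"
      using assms by (simp add: power_divide flip: add_divide_distrib)
    then obtain t where t: "0 \<le> t" "t < 2 * pi" "x $ 1 / q = cos t" "x $ 2 / q = sin t"
      using sincos_total_2pi by metis
    then have "x = \<gamma> (t / (2 * pi))"
      using assms by (simp add: \<gamma>_def vec_eq_iff forall_2 vector_2 field_simps)
    with t show "x \<in> \<gamma> ` {0..<1}"
      by (auto intro!: image_eqI[of _ _ "t / (2 * pi)"])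
  qed
  then have "hausdorff1_outer (sphere (0 :: real ^ 2) q) \<le> hausdorff1_outer (\<gamma> ` {0..<1})"
    by (rule hausdorff1_outer_mono)
  also have "\<dots> \<le> ennreal (q * 4 * pi)"
  proof (rule hausdorff1_outer_lipschitz_image_le)
    fix s t :: real
    have "dist (\<gamma> s) (\<gamma> t) \<le> (\<Sum>i\<in>UNIV. \<bar>(\<gamma> s - \<gamma> t) $ i\<bar>)"
      unfolding dist_norm by (rule norm_le_l1_cart)
    also have "\<dots> = q * \<bar>cos (2 * pi * s) - cos (2 * pi * t)\<bar> + q * \<bar>sin (2 * pi * s) - sin (2 * pi * t)\<bar>"
      using assms by (simp add: \<gamma>_def sum_2 vector_2 abs_mult flip: right_diff_distrib)
    also have "\<dots> \<le> q * \<bar>2 * pi * s - 2 * pi * t\<bar> + q * \<bar>2 * pi * s - 2 * pi * t\<bar>"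
      using assms by (intro add_mono mult_left_mono abs_cos_diff_le abs_sin_diff_le) auto
    also have "\<dots> = q * 4 * pi * \<bar>s - t\<bar>"
      by (simp add: abs_mult flip: right_diff_distrib)
    finally show "dist (\<gamma> s) (\<gamma> t) \<le> q * 4 * pi * \<bar>s - t\<bar>" .
  qed (use assms in simp)
  finally have "hausdorff1_outer (sphere (0 :: real ^ 2) q) \<le> ennreal (q * 4 * pi)" .
  from le_less_trans[OF order_trans[OF emeasure_hausdorff1_le this] ennreal_less_top]
  show ?thesis by simp
qed

section \<open>Fourier modes determine a density on the circle\<close>

context
  fixes N :: "(real ^ 2) measure" and q :: real and F :: "real ^ 2 \<Rightarrow> real"
  assumes sets_N: "sets N = sets (restrict_space borel (sphere 0 q))"
    and finite: "finite_measure N"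
    and F: "integrable N F"
begin

lemma space_N: "space N = sphere 0 q"
  using sets_eq_imp_space_eq[OF sets_N] by (simp add: space_restrict_space)

lemma integrable_times_continuous:
  fixes h :: "real ^ 2 \<Rightarrow> complex"
  assumes "continuous_on (sphere 0 q) h"
  shows "integrable N (\<lambda>x. of_real (F x) * h x)"
proof -
  have "compact (h ` sphere 0 q)"
    by (rule compact_continuous_image[OF assms compact_sphere])
  then have "bounded (h ` sphere 0 q)"
    by (rule compact_imp_bounded)
  then obtain B where "\<forall>y\<in>h ` sphere 0 q. norm y \<le> B"
    unfolding bounded_iff by (elim exE)
  then have B: "norm (h x) \<le> B" if "x \<in> sphere 0 q" for x
    using that by (rule bspec[OF _ imageI])
  have "h \<in> borel_measurable N"
    unfolding measurable_cong_sets[OF sets_N refl]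
    by (rule borel_measurable_continuous_on_restrict[OF assms])
  then have meas: "(\<lambda>x. of_real (F x) * h x) \<in> borel_measurable N"
    using borel_measurable_integrable[OF F] by simp
  have bound: "norm (of_real (F x) * h x) \<le> norm (B * \<bar>F x\<bar>)" if "x \<in> sphere 0 q" for x
  proof -
    have "norm (of_real (F x) * h x) = norm (h x) * \<bar>F x\<bar>"
      by (simp add: norm_mult)
    also have "\<dots> \<le> B * \<bar>F x\<bar>"
      by (intro mult_right_mono B that) simp
    also have "\<dots> \<le> norm (B * \<bar>F x\<bar>)" by simp
    finally show ?thesis .
  qed
  have "integrable N (\<lambda>x. B * \<bar>F x\<bar>)"
    using F by simp
  then show ?thesis
    by (rule Bochner_Integration.integrable_bound[OF _ meas AE_I2]) (rule bound, simp only: space_N)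
qed

text \<open>On the circle every polynomial is a combination of \<open>z^a conj(z)^b\<close>. Multiplying by an
  arbitrary \<open>h\<close> makes the property stable under further multiplication by polynomials, which the
  induction over products of polynomials requires.\<close>

definition moments_vanish :: "(real ^ 2 \<Rightarrow> complex) \<Rightarrow> bool" where
  "moments_vanish h \<longleftrightarrow> continuous_on (sphere 0 q) h \<and>
     (\<forall>a b. (LINT x|N. of_real (F x) * (to_complex x ^ a * cnj (to_complex x) ^ b * h x)) = 0)"

lemma continuous_on_to_complex [continuous_intros]: "continuous_on S to_complex"
  by (rule linear_continuous_on[OF bounded_linear_to_complex])

lemma moments_vanish_add:
  assumes "moments_vanish g" "moments_vanish h"
  shows "moments_vanish (\<lambda>x. g x + h x)"
proof -
  have c: "continuous_on (sphere 0 q) g" "continuous_on (sphere 0 q) h"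
    using assms by (auto simp: moments_vanish_def)
  have "integrable N (\<lambda>x. of_real (F x) * (to_complex x ^ a * cnj (to_complex x) ^ b * g x))"
    "integrable N (\<lambda>x. of_real (F x) * (to_complex x ^ a * cnj (to_complex x) ^ b * h x))" for a b
    by (intro integrable_times_continuous continuous_intros c)+
  with assms show ?thesis
    by (auto simp: moments_vanish_def ring_distribs intro!: continuous_intros)
qed

lemma moments_vanish_cmult:
  assumes "moments_vanish h"
  shows "moments_vanish (\<lambda>x. c * h x)"
proof -
  have "(LINT x|N. of_real (F x) * (to_complex x ^ a * cnj (to_complex x) ^ b * (c * h x))) =
     c * (LINT x|N. of_real (F x) * (to_complex x ^ a * cnj (to_complex x) ^ b * h x))" for a b
    by (subst integral_mult_right_zero[symmetric]) (simp add: mult_ac)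
  with assms show ?thesis
    by (auto simp: moments_vanish_def intro!: continuous_intros)
qed

lemma moments_vanish_to_complex_times:
  assumes "moments_vanish h"
  shows "moments_vanish (\<lambda>x. to_complex x * h x)"
    and "moments_vanish (\<lambda>x. cnj (to_complex x) * h x)"
proof -
  have shift: "to_complex x ^ a * cnj (to_complex x) ^ b * (to_complex x * h x) =
      to_complex x ^ Suc a * cnj (to_complex x) ^ b * h x"
    "to_complex x ^ a * cnj (to_complex x) ^ b * (cnj (to_complex x) * h x) =
      to_complex x ^ a * cnj (to_complex x) ^ Suc b * h x" for a b x
    by simp_all
  have h: "continuous_on (sphere 0 q) h"
    "(LINT x|N. of_real (F x) * (to_complex x ^ a * cnj (to_complex x) ^ b * h x)) = 0" for a b
    using assms unfolding moments_vanish_def by blast+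
  show "moments_vanish (\<lambda>x. to_complex x * h x)"
    "moments_vanish (\<lambda>x. cnj (to_complex x) * h x)"
    unfolding moments_vanish_def shift by (intro conjI allI continuous_intros h)+
qed

text \<open>A real linear form is a complex combination of \<open>z\<close> and \<open>conj z\<close>.\<close>

lemma moments_vanish_polynomial_times:
  assumes "real_polynomial_function g" "moments_vanish h"
  shows "moments_vanish (\<lambda>x. of_real (g x) * h x)"
  using assms
proof (induction g arbitrary: h)
  case (linear f)
  define \<alpha> \<beta> where "\<alpha> = f (axis 1 1)" and "\<beta> = f (axis 2 1)"
  have f: "f x = x $ 1 * \<alpha> + x $ 2 * \<beta>" for x
  proof -
    have "f x = f (x $ 1 *\<^sub>R axis 1 1 + x $ 2 *\<^sub>R axis 2 1)"
      by (rule arg_cong[where f = f]) (simp add: vec_eq_iff forall_2 axis_def)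
    also have "\<dots> = x $ 1 * \<alpha> + x $ 2 * \<beta>"
      using bounded_linear.linear[OF linear(1)] by (simp add: \<alpha>_def \<beta>_def linear_add linear_scale)
    finally show ?thesis .
  qed
  have "of_real (f x) * h x = Complex (\<alpha> / 2) (- \<beta> / 2) * (to_complex x * h x)
      + Complex (\<alpha> / 2) (\<beta> / 2) * (cnj (to_complex x) * h x)" for x
    unfolding f by (simp add: complex_eq_iff to_complex_def algebra_simps)
  then show ?case
    using moments_vanish_add[OF moments_vanish_cmult[OF moments_vanish_to_complex_times(1)[OF linear(2)]]
        moments_vanish_cmult[OF moments_vanish_to_complex_times(2)[OF linear(2)]]] by simp
next
  case (const c)
  then show ?case by (rule moments_vanish_cmult)
next
  case (add f g)
  then show ?case by (simp add: ring_distribs moments_vanish_add)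
next
  case (mult f g)
  then show ?case by (simp add: mult.assoc)
qed

text \<open>On the circle \<open>z conj(z) = q\<^sup>2\<close>, so each monomial reduces to a multiple of a power of \<open>z\<close> or of \<open>conj z\<close>.
  The parameters \<open>w = 1\<close> and \<open>w = -i\<close> give the real and imaginary parts of \<open>z^k\<close>.\<close>

lemma moments_vanish_1:
  assumes mean: "(LINT x|N. F x) = 0"
    and modes: "\<And>k w. k \<ge> 1 \<Longrightarrow> (LINT x|N. F x * Re (mode k w x)) = 0"
  shows "moments_vanish (\<lambda>x. 1)"
proof -
  have int: "integrable N (\<lambda>x. of_real (F x) * to_complex x ^ j)" for j
    by (intro integrable_times_continuous continuous_intros)
  have pow: "(LINT x|N. of_real (F x) * to_complex x ^ j) = 0" for j
  proof (cases "j = 0")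
    case True
    then show ?thesis using mean by simp
  next
    case False
    have "Re (LINT x|N. of_real (F x) * to_complex x ^ j) = 0"
      using modes[of j 1] False by (simp add: int mode_def flip: integral_Re)
    moreover have "Im (LINT x|N. of_real (F x) * to_complex x ^ j) = 0"
      using modes[of j "- \<i>"] False by (simp add: int mode_def flip: integral_Im)
    ultimately show ?thesis by (simp add: complex_eq_iff)
  qed
  have cpow: "(LINT x|N. of_real (F x) * cnj (to_complex x) ^ j) = 0" for j
  proof -
    have "(LINT x|N. of_real (F x) * cnj (to_complex x) ^ j) = (LINT x|N. cnj (of_real (F x) * to_complex x ^ j))"
      by (intro Bochner_Integration.integral_cong) simp_all
    also have "\<dots> = cnj (LINT x|N. of_real (F x) * to_complex x ^ j)"
      by (rule Bochner_Integration.integral_cnj)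
    finally show ?thesis using pow by simp
  qed
  have zz: "to_complex x * cnj (to_complex x) = of_real (q\<^sup>2)" if "x \<in> sphere 0 q" for x
    using that complex_norm_square[of "to_complex x"] by (simp add: norm_to_complex)
  have "(LINT x|N. of_real (F x) * (to_complex x ^ a * cnj (to_complex x) ^ b)) = 0" for a b
  proof (cases "a \<ge> b")
    case True
    have "to_complex x ^ a * cnj (to_complex x) ^ b = of_real (q\<^sup>2) ^ b * to_complex x ^ (a - b)"
      if "x \<in> sphere 0 q" for x
    proof -
      obtain d where "a = b + d" using True le_Suc_ex by blast
      then show ?thesis
        unfolding zz[OF that, symmetric] by (simp add: power_mult_distrib power_add mult_ac)
    qed
    then have "(LINT x|N. of_real (F x) * (to_complex x ^ a * cnj (to_complex x) ^ b)) =
        (LINT x|N. of_real (q\<^sup>2) ^ b * (of_real (F x) * to_complex x ^ (a - b)))"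
      by (intro Bochner_Integration.integral_cong) (simp_all add: space_N)
    then show ?thesis by (simp only: integral_mult_right_zero pow mult_zero_right)
  next
    case False
    have "to_complex x ^ a * cnj (to_complex x) ^ b = of_real (q\<^sup>2) ^ a * cnj (to_complex x) ^ (b - a)"
      if "x \<in> sphere 0 q" for x
    proof -
      obtain d where "b = a + d" using False le_Suc_ex nat_le_linear by blast
      then show ?thesis
        unfolding zz[OF that, symmetric] by (simp add: power_mult_distrib power_add mult_ac)
    qed
    then have "(LINT x|N. of_real (F x) * (to_complex x ^ a * cnj (to_complex x) ^ b)) =
        (LINT x|N. of_real (q\<^sup>2) ^ a * (of_real (F x) * cnj (to_complex x) ^ (b - a)))"
      by (intro Bochner_Integration.integral_cong) (simp_all add: space_N)
    then show ?thesis by (simp only: integral_mult_right_zero cpow mult_zero_right)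
  qed
  then show ?thesis by (simp add: moments_vanish_def)
qed

lemma continuous_moment_eq_0:
  fixes g :: "real ^ 2 \<Rightarrow> real"
  assumes vanish: "moments_vanish (\<lambda>x. 1)" and g: "continuous_on (sphere 0 q) g"
  shows "(LINT x|N. F x * g x) = 0"
proof (rule ccontr)
  assume "(LINT x|N. F x * g x) \<noteq> 0"
  define K where "K = (LINT x|N. \<bar>F x\<bar>)"
  have K: "K \<ge> 0" unfolding K_def by simp
  define e where "e = \<bar>LINT x|N. F x * g x\<bar> / (K + 1)"
  have e: "e > 0" using \<open>_ \<noteq> 0\<close> K by (simp add: e_def)
  obtain p where p: "real_polynomial_function p" "\<And>x. x \<in> sphere 0 q \<Longrightarrow> \<bar>g x - p x\<bar> < e"
    using Stone_Weierstrass_real_polynomial_function[OF _ g e] by auto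
  have int: "integrable N (\<lambda>x. F x * h x)" if "continuous_on (sphere 0 q) h" for h
    using integrable_Re[OF integrable_times_continuous[of "\<lambda>x. of_real (h x)"]] that
    by (simp add: continuous_on_of_real)
  have pc: "continuous_on (sphere 0 q) p"
    using p(1) by (simp add: continuous_on_polymonial_function real_polynomial_function_eq)
  have "(LINT x|N. of_real (F x) * (of_real (p x) :: complex)) = 0"
    using moments_vanish_polynomial_times[OF p(1) vanish] unfolding moments_vanish_def
    by (auto dest!: spec[of _ 0])
  then have p0: "(LINT x|N. F x * p x) = 0"
    by (simp flip: of_real_mult)
  have "\<bar>LINT x|N. F x * g x\<bar> = \<bar>LINT x|N. F x * (g x - p x)\<bar>"
    using p0 int[OF g] int[OF pc] by (simp add: right_diff_distrib)
  also have "\<dots> \<le> (LINT x|N. e * \<bar>F x\<bar>)"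
    unfolding real_norm_def[symmetric]
  proof (rule Bochner_Integration.integral_norm_bound_integral)
    show "integrable N (\<lambda>x. F x * (g x - p x))"
      by (intro int continuous_intros g pc)
    show "integrable N (\<lambda>x. e * norm (F x))" using F by simp
    fix x assume "x \<in> space N"
    then have "\<bar>g x - p x\<bar> \<le> e" using p(2)[of x] by (simp add: space_N)
    then show "norm (F x * (g x - p x)) \<le> e * norm (F x)"
      by (simp add: abs_mult mult.commute[of e] mult_left_mono)
  qed
  also have "\<dots> = e * K" by (simp add: K_def)
  also have "\<dots> < e * (K + 1)" using e by simp
  also have "\<dots> = \<bar>LINT x|N. F x * g x\<bar>" using K by (simp add: e_def)
  finally show False by simp
qed

text \<open>The indicator of a closed set is a bounded pointwise limit of continuous functions of the distance.\<close>

lemma closed_moment_eq_0: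
  assumes cont: "\<And>g :: real ^ 2 \<Rightarrow> real. continuous_on (sphere 0 q) g \<Longrightarrow> (LINT x|N. F x * g x) = 0"
    and C: "closed C"
  shows "(LINT x|N. indicator C x * F x) = 0"
proof (cases "C = {}")
  case False
  define g where "g n x = max 0 (1 - real n * infdist x C)" for n and x :: "real ^ 2"
  have gc: "continuous_on S (g n)" for n S
    unfolding g_def by (intro continuous_intros)
  have g1: "0 \<le> g n x" "g n x \<le> 1" for n x
    by (auto simp: g_def infdist_nonneg)
  have lim: "(\<lambda>n. g n x) \<longlonglongrightarrow> indicator C x" for x
  proof (cases "x \<in> C")
    case True
    then show ?thesis by (simp add: g_def)
  next
    case notC: False
    then have pos: "infdist x C > 0"
      using C False by (metis in_closed_iff_infdist_zero infdist_nonneg order_le_less)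
    obtain m :: nat where m: "real m > 1 / infdist x C" using reals_Archimedean2 by blast
    have "g n x = 0" if "n \<ge> m" for n
    proof -
      have "1 < real m * infdist x C" using m pos by (simp add: field_simps)
      also have "\<dots> \<le> real n * infdist x C" using that pos by (intro mult_right_mono) auto
      finally show ?thesis by (simp add: g_def)
    qed
    then have "\<forall>\<^sub>F n in sequentially. g n x = indicator C x"
      using notC by (auto intro: eventually_sequentiallyI[of m])
    then show ?thesis by (rule tendsto_eventually)
  qed
  have gm: "g n \<in> borel_measurable N" for n
    unfolding measurable_cong_sets[OF sets_N refl]
    by (rule borel_measurable_continuous_on_restrict[OF gc])
  have Cm: "(indicator C :: _ \<Rightarrow> real) \<in> borel_measurable N"
    unfolding measurable_cong_sets[OF sets_N refl] using C by (intro measurable_restrict_space1) simp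
  have "(\<lambda>n. LINT x|N. F x * g n x) \<longlonglongrightarrow> (LINT x|N. F x * indicator C x)"
  proof (rule integral_dominated_convergence[where w = "\<lambda>x. norm (F x)"])
    show "AE x in N. norm (F x * g n x) \<le> norm (F x)" for n
      using g1 by (intro AE_I2) (simp add: abs_mult mult_left_le)
    show "AE x in N. (\<lambda>n. F x * g n x) \<longlonglongrightarrow> F x * indicator C x"
      by (intro AE_I2 tendsto_intros lim)
  qed (use F gm Cm in auto)
  moreover have "(LINT x|N. F x * g n x) = 0" for n
    by (intro cont gc)
  ultimately show ?thesis
    by (simp add: LIMSEQ_const_iff mult.commute)
qed simp

text \<open>Closed sets form an intersection-stable generator of the Borel sets, so the integral of \<open>F\<close> vanishes
  over every Borel set.\<close>

lemma AE_eq_0_if_closed_moments_eq_0: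
  assumes closed: "\<And>C. closed C \<Longrightarrow> (LINT x|N. indicator C x * F x) = 0"
  shows "AE x in N. F x = 0"
proof -
  interpret finite_measure N by (rule finite)
  have meas: "A \<inter> sphere 0 q \<in> sets N" if "A \<in> sets borel" for A
    using that by (auto simp: sets_N sets_restrict_space)
  have eq: "(LINT x:A \<inter> sphere 0 q|N. F x) = (LINT x|N. indicator A x * F x)" for A
    unfolding set_lebesgue_integral_def
    by (intro Bochner_Integration.integral_cong) (auto simp: space_N indicator_def)
  have whole: "(LINT x|N. F x) = 0"
    using closed[of UNIV] by simp
  have "(LINT x:A \<inter> sphere 0 q|N. F x) = 0" if "A \<in> sigma_sets UNIV (Collect closed)" for A
  proof (rule sigma_sets_induct_disjoint[OF _ _ that])
    show "Int_stable (Collect closed)" by (auto simp: Int_stable_def)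
    fix A :: "(real ^ 2) set"
    assume A: "A \<in> sigma_sets UNIV (Collect closed)" "(LINT x:A \<inter> sphere 0 q|N. F x) = 0"
    have "(LINT x|N. indicator (UNIV - A) x * F x) = (LINT x|N. F x - indicator A x * F x)"
      by (intro Bochner_Integration.integral_cong) (auto simp: indicator_def)
    also have "\<dots> = (LINT x|N. F x) - (LINT x|N. indicator A x * F x)"
    proof (rule Bochner_Integration.integral_diff[OF F])
      have "A \<in> sets borel" using A(1) by (simp add: borel_eq_closed)
      then have "integrable N (\<lambda>x. indicator (A \<inter> sphere 0 q) x *\<^sub>R F x)"
        by (intro integrable_mult_indicator[OF meas F])
      also have "?this \<longleftrightarrow> integrable N (\<lambda>x. indicator A x * F x)"
        by (intro Bochner_Integration.integrable_cong) (auto simp: space_N indicator_def)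
      finally show "integrable N (\<lambda>x. indicator A x * F x)" .
    qed
    finally show "(LINT x:(UNIV - A) \<inter> sphere 0 q|N. F x) = 0"
      using A(2) whole by (simp add: eq)
  next
    fix A :: "nat \<Rightarrow> (real ^ 2) set"
    assume A: "disjoint_family A" "range A \<subseteq> sigma_sets UNIV (Collect closed)"
      "\<And>i. (LINT x:A i \<inter> sphere 0 q|N. F x) = 0"
    have Am: "A i \<inter> sphere 0 q \<in> sets N" for i
      using A(2) by (intro meas) (auto simp: borel_eq_closed)
    have "(LINT x:(\<Union>i. A i \<inter> sphere 0 q)|N. F x) = (\<Sum>i. (LINT x:A i \<inter> sphere 0 q|N. F x))"
    proof (rule lebesgue_integral_countable_add)
      show "set_integrable N (\<Union>i. A i \<inter> sphere 0 q) F"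
        unfolding set_integrable_def by (intro integrable_mult_indicator F sets.countable_UN) (use Am in blast)
      show "A i \<inter> sphere 0 q \<inter> (A j \<inter> sphere 0 q) = {}" if "i \<noteq> j" for i j
        using A(1) that by (auto simp: disjoint_family_on_def)
    qed (rule Am)
    moreover have "\<Union> (range A) \<inter> sphere 0 q = (\<Union>i. A i \<inter> sphere 0 q)" by blast
    ultimately show "(LINT x:\<Union> (range A) \<inter> sphere 0 q|N. F x) = 0"
      by (simp only: A(3) suminf_zero)
  next
    fix C :: "(real ^ 2) set" assume "C \<in> Collect closed"
    then show "(LINT x:C \<inter> sphere 0 q|N. F x) = 0"
      unfolding eq by (intro closed) simp
  qed (simp_all add: set_lebesgue_integral_def)
  then have borel: "(LINT x:A \<inter> sphere 0 q|N. F x) = 0" if "A \<in> sets borel" for A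
    using that by (simp add: borel_eq_closed)
  have "(LINT x:A|N. F x) = 0" if "A \<in> sets N" for A
  proof -
    have "A \<in> (\<inter>) (sphere 0 q) ` sets borel"
      using that by (simp only: sets_N sets_restrict_space)
    then obtain B where "B \<in> sets borel" "A = sphere 0 q \<inter> B"
      by (rule imageE)
    then show ?thesis using borel[of B] by (simp add: Int_commute)
  qed
  then show ?thesis by (rule density_zero[OF F])
qed

lemma AE_eq_0_if_modes_vanish:
  assumes "(LINT x|N. F x) = 0" "\<And>k w. k \<ge> 1 \<Longrightarrow> (LINT x|N. F x * Re (mode k w x)) = 0"
  shows "AE x in N. F x = 0"
proof (rule AE_eq_0_if_closed_moments_eq_0)
  have "(LINT x|N. F x * g x) = 0" if "continuous_on (sphere 0 q) g" for g
    by (rule continuous_moment_eq_0[OF moments_vanish_1[OF assms] that])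
  then show "(LINT x|N. indicator C x * F x) = 0" if "closed C" for C
    using that by (rule closed_moment_eq_0)
qed

end

text \<open>The measure on the circle is completed, so \<open>F\<close> is first replaced by a Borel measurable
  representative, which is integrable because the circle has finite length.\<close>

lemma circle_source_excites_mode:
  fixes F :: "real ^ 2 \<Rightarrow> real"
  assumes q: "q > 0"
    and F: "square_integrable (hausdorff1_on (sphere 0 q)) F"
    and mean: "(LINT x|hausdorff1_on (sphere 0 q). F x) = 0"
    and nz: "\<not> (AE x in hausdorff1_on (sphere 0 q). F x = 0)"
  obtains k w where "k \<ge> 1" "(LINT x|hausdorff1_on (sphere 0 q). F x * Re (mode k w x)) \<noteq> 0"
proof -
  define N where "N = restrict_space hausdorff1 (sphere (0 :: real ^ 2) q)"
  have H: "hausdorff1_on (sphere 0 q) = completion N"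
    by (simp add: hausdorff1_on_def N_def)
  have sets_N: "sets N = sets (restrict_space borel (sphere 0 q))"
    unfolding N_def by (intro sets_restrict_space_cong sets_hausdorff1)
  have space_N: "space N = sphere 0 q"
    by (simp add: N_def space_restrict_space)
  have "emeasure N (space N) = emeasure hausdorff1 (sphere (0 :: real ^ 2) q)"
    unfolding space_N unfolding N_def by (intro emeasure_restrict_space) auto
  then interpret finite_measure N
    using emeasure_hausdorff1_circle_finite[OF q] by (intro finite_measureI) auto
  have Fm: "F \<in> borel_measurable (completion N)" and F2: "integrable (completion N) (\<lambda>x. (F x)\<^sup>2)"
    using F by (auto simp: square_integrable_def H)
  obtain F' where F': "F' \<in> borel_measurable N" "AE x in N. F x = F' x"
    using completion_ex_borel_measurable_real[OF Fm] by blast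
  have F'm: "F' \<in> borel_measurable (completion N)"
    using F'(1) by (rule measurable_completion)
  have ae: "AE x in completion N. F x = F' x"
    using F'(2) by (rule AE_completion)
  have "integrable (completion N) (\<lambda>x. (F' x)\<^sup>2)"
    using F2 by (rule integrable_cong_AE_imp) (use F'm ae in auto)
  then have F'2: "integrable N (\<lambda>x. (F' x)\<^sup>2)"
    using F'(1) by (subst (asm) integrable_completion) auto
  have "integrable N (\<lambda>x. 1 + (F' x)\<^sup>2)"
    using F'2 by simp
  then have F'i: "integrable N F'"
  proof (rule Bochner_Integration.integrable_bound)
    have "\<bar>y\<bar> \<le> \<bar>1 + y\<^sup>2\<bar>" for y :: real
      using sum_squares_bound[of 1 "\<bar>y\<bar>"] by simp
    then show "AE x in N. norm (F' x) \<le> norm (1 + (F' x)\<^sup>2)" by simp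
  qed (rule F'(1))
  have transfer: "(LINT x|completion N. F x * h x) = (LINT x|N. F' x * h x)"
    if h: "h \<in> borel_measurable N" for h
  proof -
    have "h \<in> borel_measurable (completion N)" using h by (rule measurable_completion)
    then have "(LINT x|completion N. F x * h x) = (LINT x|completion N. F' x * h x)"
      using Fm F'm ae by (intro integral_cong_AE) auto
    also have "\<dots> = (LINT x|N. F' x * h x)"
      using F'(1) h by (intro integral_completion) auto
    finally show ?thesis .
  qed
  have mode_measurable: "(\<lambda>x. Re (mode k w x)) \<in> borel_measurable N" for k w
  proof -
    have "continuous_on UNIV (\<lambda>x. Re (mode k w x))"
      using smooth_cont_diff[OF smooth_mode(1), of 0 k w] by simp
    then show ?thesis
      unfolding measurable_cong_sets[OF sets_N refl]
      by (intro measurable_restrict_space1 borel_measurable_continuous_onI)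
  qed
  have "\<not> (AE x in N. F' x = 0)"
  proof
    assume "AE x in N. F' x = 0"
    then have "AE x in N. F x = 0" using F'(2) by eventually_elim simp
    with nz show False unfolding H by (simp add: AE_completion)
  qed
  moreover have "(LINT x|N. F' x) = 0"
    using transfer[of "\<lambda>_. 1"] mean by (simp add: H)
  ultimately obtain k w where "k \<ge> 1" "(LINT x|N. F' x * Re (mode k w x)) \<noteq> 0"
    using AE_eq_0_if_modes_vanish[OF sets_N finite_measure_axioms F'i] by blast
  with that show ?thesis
    unfolding H by (simp add: transfer[OF mode_measurable])
qed

section \<open>Resonance\<close>

lemma nn_integral_inverse_1_plus_square:
  "(\<integral>\<^sup>+x. ennreal (1 / (1 + x\<^sup>2)) \<partial>lborel) < \<infinity>"
proof -
  have half: "(\<integral>\<^sup>+x. ennreal (1 / (1 + x\<^sup>2)) * indicator {0..} x \<partial>lborel) = ennreal (pi / 2 - arctan 0)"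
    by (rule nn_integral_FTC_atLeast)
       (auto intro!: derivative_eq_intros tendsto_arctan_at_top simp: inverse_eq_divide)
  have "(\<integral>\<^sup>+x. ennreal (1 / (1 + x\<^sup>2)) * indicator {..0} x \<partial>lborel) =
      (\<integral>\<^sup>+x. ennreal (1 / (1 + (0 + -1 * x)\<^sup>2)) * indicator {..0} (0 + -1 * x) \<partial>lborel)"
    by (subst nn_integral_real_affine[where c = "-1" and t = 0]) auto
  also have "\<dots> = (\<integral>\<^sup>+x. ennreal (1 / (1 + x\<^sup>2)) * indicator {0..} x \<partial>lborel)"
    by (intro nn_integral_cong) (auto simp: indicator_def)
  finally have half': "(\<integral>\<^sup>+x. ennreal (1 / (1 + x\<^sup>2)) * indicator {..0} x \<partial>lborel) = ennreal (pi / 2 - arctan 0)"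
    using half by simp
  have "(\<integral>\<^sup>+x. ennreal (1 / (1 + x\<^sup>2)) \<partial>lborel) \<le>
      (\<integral>\<^sup>+x. (ennreal (1 / (1 + x\<^sup>2)) * indicator {0..} x + ennreal (1 / (1 + x\<^sup>2)) * indicator {..0} x) \<partial>lborel)"
    by (intro nn_integral_mono) (auto simp: indicator_def)
  also have "\<dots> = ennreal (pi / 2 - arctan 0) + ennreal (pi / 2 - arctan 0)"
    by (subst nn_integral_add) (auto simp: half half')
  also have "\<dots> < \<infinity>" by simp
  finally show ?thesis .
qed

text \<open>Since \<open>(1 + x\<^sub>1\<^sup>2) (1 + x\<^sub>2\<^sup>2) \<le> (1 + |x|\<^sup>2)\<^sup>2\<close>, the integrand is dominated by a product of
  one-dimensional integrable functions.\<close>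

lemma integrable_inverse_1_plus_norm_square_squared:
  "integrable lebesgue (\<lambda>x :: real ^ 2. (1 / (1 + (norm x)\<^sup>2))\<^sup>2)"
proof -
  have Basis2: "(Basis :: (real ^ 2) set) = {axis 1 1, axis 2 1}" "(axis 1 1 :: real ^ 2) \<noteq> axis 2 1"
    unfolding Basis_vec_def by (auto simp: UNIV_2 axis_eq_axis)
  let ?f = "\<lambda>x :: real. 1 / (1 + x\<^sup>2)"
  have le: "(1 / (1 + (norm x)\<^sup>2))\<^sup>2 \<le> (\<Prod>b\<in>Basis. ?f (x \<bullet> b))" for x :: "real ^ 2"
  proof -
    have nx: "(norm x)\<^sup>2 = (x $ 1)\<^sup>2 + (x $ 2)\<^sup>2"
      unfolding power2_norm_eq_inner inner_vec_def by (simp add: sum_2 power2_eq_square)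
    have "(1 + a) * (1 + b) \<le> (1 + (a + b))\<^sup>2" if "a \<ge> 0" "b \<ge> 0" for a b :: real
    proof -
      have "0 \<le> a + b + a * a + a * b + b * b" using that by simp
      then show ?thesis by (simp add: power2_eq_square algebra_simps)
    qed
    then have "(1 + (x $ 1)\<^sup>2) * (1 + (x $ 2)\<^sup>2) \<le> (1 + (norm x)\<^sup>2)\<^sup>2"
      unfolding nx by simp
    then show ?thesis
      using Basis2(2) by (simp add: Basis2(1) inner_axis power_divide divide_simps add_pos_nonneg
         zero_less_mult_iff)
  qed
  have "(\<integral>\<^sup>+x. ennreal ((1 / (1 + (norm x)\<^sup>2))\<^sup>2) \<partial>(lborel :: (real ^ 2) measure))
      \<le> (\<integral>\<^sup>+x. (\<Prod>b\<in>Basis. ennreal (?f (x \<bullet> b))) \<partial>(lborel :: (real ^ 2) measure))"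
    by (intro nn_integral_mono) (subst prod_ennreal, auto intro!: ennreal_leI le)
  also have "\<dots> = (\<Prod>b\<in>(Basis :: (real ^ 2) set). (\<integral>\<^sup>+x. ennreal (?f x) \<partial>lborel))"
    by (subst nn_integral_lborel_prod) auto
  also have "\<dots> < \<infinity>"
    using nn_integral_inverse_1_plus_square by (simp add: Basis2 ennreal_mult_less_top)
  finally have "integrable lborel (\<lambda>x :: real ^ 2. (1 / (1 + (norm x)\<^sup>2))\<^sup>2)"
    by (intro integrableI_bounded) auto
  then show ?thesis
    by (subst integrable_completion) auto
qed

text \<open>The constant is uniform in \<open>\<eta>\<close> and in the solution, so it serves every family of solutions at once.\<close>

lemma energy_lower_bound:
  fixes F :: "real ^ 2 \<Rightarrow> real"
  assumes R: "R > 0" and q: "q > R" and k: "k \<ge> 1"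
    and excited: "(LINT x|hausdorff1_on (sphere 0 q). F x * Re (mode k w x)) \<noteq> 0"
  obtains c where "c > 0" "\<And>\<eta> u. \<eta> > 0 \<Longrightarrow>
    weak_solution (lossy_coeff (coreless_coeff R) \<eta>) (curve_source (sphere 0 q) F) u \<Longrightarrow> c / \<eta> \<le> energy \<eta> u"
proof -
  have R2: "R\<^sup>2 > 0" and Rq: "R\<^sup>2 < q\<^sup>2" using R q by (auto intro: power_strict_mono)
  define C where "C = (2 * real k + 5) * (norm w * real k * R ^ (k - 1) * (1 + R\<^sup>2))"
  define D where "D x = C * (1 / (1 + (norm x)\<^sup>2))" for x :: "real ^ 2"
  \<comment> \<open>The summand \<open>1\<close> keeps \<open>K\<close> positive, since the final bound divides by it.\<close>
  define K where "K = (LINT x|lebesgue. (D x)\<^sup>2) + 1"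
  \<comment> \<open>The profiles have the right properties only from index \<open>1\<close> on.\<close>
  define \<phi> \<psi> where "\<phi> n x = Re (plasmon k (R\<^sup>2) (Suc n) w x)" and "\<psi> n x = Im (plasmon k (R\<^sup>2) (Suc n) w x)"
    for n and x
  define m where "m = (LINT x|hausdorff1_on (sphere 0 q). F x * Re (mode k w x))"
  define c0 where "c0 = (R\<^sup>2 / (2 * q\<^sup>2)) ^ k * exp (- 2) * \<bar>m\<bar>"
  have c0: "c0 > 0" using excited R q by (simp add: c0_def m_def)
  have D2: "integrable lebesgue (\<lambda>x. (D x)\<^sup>2)"
    unfolding D_def power_mult_distrib by (intro integrable_mult_right integrable_inverse_1_plus_norm_square_squared)
  have Dm: "D \<in> borel_measurable lebesgue"
    unfolding D_def[abs_def] by (intro measurable_completion) simp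
  have D: "square_integrable lebesgue D"
    using D2 Dm by (simp add: square_integrable_def)
  have K: "K > 0" unfolding K_def by (intro add_nonneg_pos) simp_all
  have supp: "compact (closure {x. \<phi> n x \<noteq> 0})" "compact (closure {x. \<psi> n x \<noteq> 0})" for n
  proof -
    have sub: "{x. \<phi> n x \<noteq> 0} \<subseteq> cball 0 (real (Suc n))" "{x. \<psi> n x \<noteq> 0} \<subseteq> cball 0 (real (Suc n))"
    proof -
      have vanish: "plasmon k (R\<^sup>2) (Suc n) w x = 0" if "x \<notin> cball 0 (real (Suc n))" for x
        using that by (intro plasmon_eq_0) auto
      have "\<phi> n x = 0" "\<psi> n x = 0" if "x \<notin> cball 0 (real (Suc n))" for x
        by (simp_all add: \<phi>_def \<psi>_def vanish[OF that])
      then show "{x. \<phi> n x \<noteq> 0} \<subseteq> cball 0 (real (Suc n))" "{x. \<psi> n x \<noteq> 0} \<subseteq> cball 0 (real (Suc n))"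
        by blast+
    qed
    show "compact (closure {x. \<phi> n x \<noteq> 0})" "compact (closure {x. \<psi> n x \<noteq> 0})"
      unfolding compact_closure
      by (rule bounded_subset[OF bounded_cball sub(1)], rule bounded_subset[OF bounded_cball sub(2)])
  qed
  have smooth: "smooth (\<phi> n)" "smooth (\<psi> n)" for n
    unfolding \<phi>_def[abs_def] \<psi>_def[abs_def] by (intro smooth_plasmon R2)+
  have dom: "\<bar>partial_deriv i (\<phi> n) x\<bar> \<le> D x" "\<bar>partial_deriv i (\<psi> n) x\<bar> \<le> D x" for i n x
    unfolding \<phi>_def[abs_def] \<psi>_def[abs_def] D_def C_def
    by (rule partial_derivs_plasmon_bound[OF k _ R], simp)+
  have ae: "AE x :: real ^ 2 in lebesgue. norm x \<noteq> R"
  proof -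
    have "sphere (0 :: real ^ 2) R \<in> null_sets lebesgue"
      using negligible_sphere by (simp add: negligible_iff_null_sets)
    from AE_not_in[OF this] show ?thesis by simp
  qed
  have lim: "AE x in lebesgue. (\<lambda>n. coreless_coeff R x * partial_deriv 1 (\<phi> n) x + partial_deriv 2 (\<psi> n) x) \<longlonglongrightarrow> 0"
    "AE x in lebesgue. (\<lambda>n. coreless_coeff R x * partial_deriv 2 (\<phi> n) x - partial_deriv 1 (\<psi> n) x) \<longlonglongrightarrow> 0"
  proof -
    have "(\<lambda>n. coreless_coeff R x * partial_deriv 1 (\<phi> n) x + partial_deriv 2 (\<psi> n) x) \<longlonglongrightarrow> 0"
      "(\<lambda>n. coreless_coeff R x * partial_deriv 2 (\<phi> n) x - partial_deriv 1 (\<psi> n) x) \<longlonglongrightarrow> 0"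
      if "norm x \<noteq> R" for x
      using plasmon_flux_defect_tendsto_0[OF k R that, of w, THEN LIMSEQ_Suc]
      by (simp_all only: \<phi>_def[abs_def] \<psi>_def[abs_def])
    with ae show "AE x in lebesgue. (\<lambda>n. coreless_coeff R x * partial_deriv 1 (\<phi> n) x + partial_deriv 2 (\<psi> n) x) \<longlonglongrightarrow> 0"
      "AE x in lebesgue. (\<lambda>n. coreless_coeff R x * partial_deriv 2 (\<phi> n) x - partial_deriv 1 (\<psi> n) x) \<longlonglongrightarrow> 0"
      by (auto elim: eventually_mono)
  qed
  have A: "coreless_coeff R \<in> borel_measurable lebesgue" "\<bar>coreless_coeff R x\<bar> \<le> 1" for x
  proof -
    have "(\<lambda>x :: real ^ 2. if norm x \<le> R then - 1 else 1 :: real) \<in> borel_measurable borel"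
      by measurable
    then show "coreless_coeff R \<in> borel_measurable lebesgue"
      unfolding coreless_coeff_def[abs_def] by (intro measurable_completion) simp
  qed (simp add: coreless_coeff_def)
  \<comment> \<open>On the source circle the profile is constant, so only a moment of \<open>F\<close> remains.\<close>
  have source: "curve_source (sphere 0 q) F (\<phi> n) = profile k (R\<^sup>2) (Suc n) (q\<^sup>2) * m" for n
  proof -
    have sp: "space (hausdorff1_on (sphere (0 :: real ^ 2) q)) = sphere 0 q"
      by (simp add: hausdorff1_on_def space_restrict_space)
    have "curve_source (sphere 0 q) F (\<phi> n) =
        (LINT x|hausdorff1_on (sphere 0 q). profile k (R\<^sup>2) (Suc n) (q\<^sup>2) * (F x * Re (mode k w x)))"
      unfolding curve_source_def \<phi>_def
      by (intro Bochner_Integration.integral_cong) (simp_all add: sp plasmon_def)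
    then show ?thesis by (simp add: m_def)
  qed
  have large: "\<forall>\<^sub>F n in sequentially. c0 \<le> \<bar>curve_source (sphere 0 q) F (\<phi> n)\<bar>"
  proof -
    have "\<forall>\<^sub>F n in sequentially. (R\<^sup>2 / (2 * q\<^sup>2)) ^ k * exp (- 2) \<le> profile k (R\<^sup>2) (Suc n) (q\<^sup>2)"
      using profile_lower_bound[OF k R2 Rq] by (subst eventually_sequentially_Suc)
    then show ?thesis
    proof eventually_elim
      case (elim n)
      then have "(R\<^sup>2 / (2 * q\<^sup>2)) ^ k * exp (- 2) \<le> \<bar>profile k (R\<^sup>2) (Suc n) (q\<^sup>2)\<bar>"
        by linarith
      then show ?case
        unfolding source abs_mult c0_def by (intro mult_right_mono) auto
    qed
  qed
  show ?thesis
  proof (rule that)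
    show "c0\<^sup>2 / (8 * K) > 0" using c0 K by simp
    fix \<eta> u assume \<eta>: "\<eta> > 0"
      and sol: "weak_solution (lossy_coeff (coreless_coeff R) \<eta>) (curve_source (sphere 0 q) F) u"
    define G where "G = weak_grad u"
    have "u \<in> H1_dot" using sol by (simp add: weak_solution_def)
    then have G: "has_weak_gradient u G" "square_integrable lebesgue G"
      unfolding H1_dot_def G_def weak_grad_def
      by (simp_all add: someI_ex[of "has_weak_gradient u"])
    define X where "X = (LINT x|lebesgue. (norm (G x))\<^sup>2)"
    have test: "test_function (\<phi> n)" for n
      using smooth_cont_diff[OF smooth(1)] supp(1) by (simp add: test_function_def)
    have eq: "- (LINT x|lebesgue. (of_real (coreless_coeff R x) + \<i> * of_real \<eta>) *
        (\<Sum>i\<in>UNIV. G x $ i * of_real (partial_deriv i (\<phi> n) x))) =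
        of_real (curve_source (sphere 0 q) F (\<phi> n))" for n
      using sol test[of n] unfolding weak_solution_def G_def lossy_coeff_def by blast
    note flux = flux_estimate[OF G A D smooth supp(2) dom lim eq \<eta> large]
    \<comment> \<open>Young's inequality with weight \<open>t\<close> replaces Cauchy-Schwarz; this \<open>t\<close> lets the term \<open>\<eta> K / t\<close> equal
      \<open>c0 / 2\<close>, to be absorbed on the left.\<close>
    define t where "t = 2 * \<eta> * K / c0"
    have t: "t > 0" using \<eta> K c0 by (simp add: t_def)
    have "(LINT x|lebesgue. 2 * (norm (G x) * D x)) \<le> (LINT x|lebesgue. t * (norm (G x))\<^sup>2 + (D x)\<^sup>2 / t)"
    proof (rule integral_mono)
      show "integrable lebesgue (\<lambda>x. 2 * (norm (G x) * D x))"
        using flux(1) by simp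
      show "integrable lebesgue (\<lambda>x. t * (norm (G x))\<^sup>2 + (D x)\<^sup>2 / t)"
        using G(2) D2 by (auto simp: square_integrable_def)
      fix x
      have "2 * (t * norm (G x)) * D x \<le> (t * norm (G x))\<^sup>2 + (D x)\<^sup>2"
        by (rule sum_squares_bound)
      then show "2 * (norm (G x) * D x) \<le> t * (norm (G x))\<^sup>2 + (D x)\<^sup>2 / t"
        using t by (simp add: field_simps power2_eq_square)
    qed
    also have "\<dots> = t * X + (K - 1) / t"
      using G(2) D2 by (simp add: square_integrable_def X_def K_def)
    also have "\<dots> \<le> t * X + K / t"
      using t by (simp add: divide_right_mono)
    finally have "c0 \<le> \<eta> * (t * X + K / t)"
      using flux(2) \<eta> by (meson mult_left_mono less_imp_le order_trans)
    also have "\<dots> = 2 * \<eta>\<^sup>2 * K * X / c0 + c0 / 2"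
      using \<eta> K c0 by (simp add: t_def field_simps power2_eq_square)
    finally have "c0\<^sup>2 \<le> 4 * \<eta>\<^sup>2 * K * X"
      using c0 by (simp add: field_simps power2_eq_square)
    then have "c0\<^sup>2 / (8 * K) / \<eta> \<le> \<eta> / 2 * X"
      using \<eta> K by (simp add: field_simps power2_eq_square)
    then show "c0\<^sup>2 / (8 * K) / \<eta> \<le> energy \<eta> u"
      by (simp add: energy_def X_def G_def)
  qed
qed

theorem proposition3p2:
  fixes R q :: real
    and F :: "real ^ 2 \<Rightarrow> real"
    and u :: "real \<Rightarrow> real ^ 2 \<Rightarrow> complex"
  assumes "R > 0"
    and "q > R"
    and "square_integrable (hausdorff1_on (sphere 0 q)) F"
    and "(LINT x|hausdorff1_on (sphere 0 q). F x) = 0"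
    and "\<not> (AE x in hausdorff1_on (sphere 0 q). F x = 0)"
    and "solution_family (coreless_coeff R) (curve_source (sphere 0 q) F) u"
    and "\<forall>\<eta>>0. ae_vanishes_at_infinity (weak_grad (u \<eta>))"
  shows "resonant (coreless_coeff R) (curve_source (sphere 0 q) F) \<and>
    filterlim (\<lambda>\<eta>. energy \<eta> (u \<eta>)) at_top (at_right 0)"
proof -
  have "q > 0" using assms(1,2) by simp
  from circle_source_excites_mode[OF this assms(3-5)]
  obtain k w where "k \<ge> 1" "(LINT x|hausdorff1_on (sphere 0 q). F x * Re (mode k w x)) \<noteq> 0" .
  from energy_lower_bound[OF assms(1,2) this]
  obtain c where c: "c > 0" and bound: "\<And>\<eta> v. \<eta> > 0 \<Longrightarrow>
    weak_solution (lossy_coeff (coreless_coeff R) \<eta>) (curve_source (sphere 0 q) F) v \<Longrightarrow> c / \<eta> \<le> energy \<eta> v"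
    by blast
  have blow_up: "filterlim (\<lambda>\<eta>. energy \<eta> (v \<eta>)) at_top (at_right 0)"
    if v: "solution_family (coreless_coeff R) (curve_source (sphere 0 q) F) v" for v
  proof (rule filterlim_at_top_mono)
    show "filterlim (\<lambda>\<eta>. c * inverse \<eta>) at_top (at_right 0)"
      using filterlim_tendsto_pos_mult_at_top[OF tendsto_const c filterlim_inverse_at_top_right] .
    show "\<forall>\<^sub>F \<eta> in at_right 0. c * inverse \<eta> \<le> energy \<eta> (v \<eta>)"
      using bound v
      by (auto simp: solution_family_def divide_inverse intro: eventually_mono[OF eventually_at_right_less])
  qed
  have "Limsup (at_right 0) (\<lambda>\<eta>. ereal (energy \<eta> (v \<eta>))) = \<infinity>"
    if "solution_family (coreless_coeff R) (curve_source (sphere 0 q) F) v" for v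
    using blow_up[OF that]
    by (intro lim_imp_Limsup) (simp_all add: tendsto_PInfty_eq_at_top)
  then show ?thesis
    using blow_up[OF assms(6)] assms(6) by (auto simp: resonant_def)
qed

end
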